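(* Let $\mathbf{k}$ be a commutative unital ring, $\lambda\in\mathbf{k}$, let $A$ be a unital associative $\mathbf{k}$-algebra and let $r=\sum_i u_i\otimes v_i\in A\otimes A$. Then the linear map $$\Delta_r: A\to A\otimes A,\qquad \Delta_r(a)=a\cdot r-r\cdot a-\lambda(a\otimes 1)$$ is coassociative, i.e. $(\Delta_r\otimes \mathrm{id})\circ\Delta_r=(\mathrm{id}\otimes\Delta_r)\circ\Delta_r$, if and only if the element $$r_{13}r_{12}-r_{12}r_{23}+r_{23}r_{13}-\lambda r_{13}\in A\otimes A\otimes A$$ is $A$-invariant.
   Context: Tensor products are over $\mathbf{k}$. $A\otimes A$ is an $A$-bimodule via $a\cdot(b\otimes c)=ab\otimes c$ and $(b\otimes c)\cdot a=b\otimes ca$; $A\otimes A\otimes A$ is an $A$-bimodule via $a\cdot(b\otimes c\otimes d)=ab\otimes c\otimes d$ and $(b\otimes c\otimes d)\cdot a=b\otimes c\otimes da$. An element $w$ of an $A$-bimodule is $A$-invariant if $a\cdot w=w\cdot a$ for all $a\in A$. For $r=\sum_i u_i\otimes v_i$, set $r_{12}=\sum_i u_i\otimes v_i\otimes 1$, $r_{13}=\sum_i u_i\otimes 1\otimes v_i$, $r_{23}=\sum_i 1\otimes u_i\otimes v_i$, with products taken in the tensor product algebra $A\otimes A\otimes A$ (componentwise multiplication). *)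

theory Defs
  imports "HOL-Algebra.Module" "HOL-Algebra.AbelCoset"
begin

section \<open>Unital associative algebras and linear maps\<close>

text \<open>The library's \<^locale>\<open>algebra\<close> covers commutative algebras only.\<close>

locale unital_algebra = module R A + A: ring A for R (structure) and A (structure) +
  assumes smult_mult_left:
      "\<lbrakk>c \<in> carrier R; x \<in> carrier A; y \<in> carrier A\<rbrakk> \<Longrightarrow>
       (c \<odot>\<^bsub>A\<^esub> x) \<otimes>\<^bsub>A\<^esub> y = c \<odot>\<^bsub>A\<^esub> (x \<otimes>\<^bsub>A\<^esub> y)"
    and smult_mult_right:
      "\<lbrakk>c \<in> carrier R; x \<in> carrier A; y \<in> carrier A\<rbrakk> \<Longrightarrow>
       x \<otimes>\<^bsub>A\<^esub> (c \<odot>\<^bsub>A\<^esub> y) = c \<odot>\<^bsub>A\<^esub> (x \<otimes>\<^bsub>A\<^esub> y)"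

definition linear_hom ::
  "('k, 'r) ring_scheme \<Rightarrow> ('k, 'm, 'u) module_scheme \<Rightarrow> ('k, 'n, 'v) module_scheme \<Rightarrow> ('m \<Rightarrow> 'n) set"
  where "linear_hom R M N =
    {f \<in> carrier M \<rightarrow> carrier N.
       (\<forall>x\<in>carrier M. \<forall>y\<in>carrier M. f (x \<oplus>\<^bsub>M\<^esub> y) = f x \<oplus>\<^bsub>N\<^esub> f y) \<and>
       (\<forall>c\<in>carrier R. \<forall>x\<in>carrier M. f (c \<odot>\<^bsub>M\<^esub> x) = c \<odot>\<^bsub>N\<^esub> f x)}"

definition bilinear_maps ::
  "('k, 'r) ring_scheme \<Rightarrow> ('k, 'm, 'u) module_scheme \<Rightarrow> ('k, 'n, 'v) module_scheme \<Rightarrow>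
   ('k, 'p, 'w) module_scheme \<Rightarrow> ('m \<Rightarrow> 'n \<Rightarrow> 'p) set"
  where "bilinear_maps R M N P =
    {\<beta>. (\<forall>x\<in>carrier M. \<beta> x \<in> linear_hom R N P) \<and>
        (\<forall>y\<in>carrier N. (\<lambda>x. \<beta> x y) \<in> linear_hom R M P)}"


section \<open>Tensor products of modules over a commutative ring\<close>

text \<open>
  \<open>M \<otimes> N\<close> is the quotient of the free module on \<open>carrier M \<times> carrier N\<close> by the submodule
  generated by the bilinearity relations.  Modules, submodules and cosets are those of HOL-Algebra;
  the fields \<open>mult\<close> and \<open>one\<close> of a module record carry no meaning for a bare module and are
  left undefined.
\<close>

definition free_module :: "('k, 'r) ring_scheme \<Rightarrow> 'x set \<Rightarrow> ('k, 'x \<Rightarrow> 'k) module"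
  where "free_module R X =
    \<lparr>carrier = {f. (\<forall>x. f x \<in> carrier R) \<and> (\<forall>x. x \<notin> X \<longrightarrow> f x = \<zero>\<^bsub>R\<^esub>) \<and> finite {x. f x \<noteq> \<zero>\<^bsub>R\<^esub>}},
     mult = undefined, one = undefined,
     zero = (\<lambda>x. \<zero>\<^bsub>R\<^esub>), add = (\<lambda>f g x. f x \<oplus>\<^bsub>R\<^esub> g x),
     smult = (\<lambda>c f x. c \<otimes>\<^bsub>R\<^esub> f x)\<rparr>"

definition free_gen :: "('k, 'r) ring_scheme \<Rightarrow> 'x \<Rightarrow> 'x \<Rightarrow> 'k"
  where "free_gen R x = (\<lambda>y. if y = x then \<one>\<^bsub>R\<^esub> else \<zero>\<^bsub>R\<^esub>)"

definition generated_submodule ::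
  "('k, 'r) ring_scheme \<Rightarrow> ('k, 'm, 'u) module_scheme \<Rightarrow> 'm set \<Rightarrow> 'm set"
  where "generated_submodule R M S = \<Inter> {H. submodule H R M \<and> S \<subseteq> H}"

definition quotient_module ::
  "('k, 'm, 'u) module_scheme \<Rightarrow> 'm set \<Rightarrow> ('k, 'm set) module"
  where "quotient_module M H =
    \<lparr>carrier = a_rcosets\<^bsub>M\<^esub> H, mult = undefined, one = undefined,
     zero = H, add = (\<lambda>X Y. X <+>\<^bsub>M\<^esub> Y),
     smult = (\<lambda>c X. \<Union>x\<in>X. H +>\<^bsub>M\<^esub> (c \<odot>\<^bsub>M\<^esub> x))\<rparr>"

definition bilinear_relators ::
  "('k, 'r) ring_scheme \<Rightarrow> ('k, 'm, 'u) module_scheme \<Rightarrow> ('k, 'n, 'v) module_scheme \<Rightarrow>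
   ('m \<times> 'n \<Rightarrow> 'k) set"
  where "bilinear_relators R M N =
    (let F = free_module R (carrier M \<times> carrier N); e = (\<lambda>x y. free_gen R (x, y)) in
      {e (x \<oplus>\<^bsub>M\<^esub> x') y \<ominus>\<^bsub>F\<^esub> (e x y \<oplus>\<^bsub>F\<^esub> e x' y) | x x' y.
          x \<in> carrier M \<and> x' \<in> carrier M \<and> y \<in> carrier N} \<union>
      {e x (y \<oplus>\<^bsub>N\<^esub> y') \<ominus>\<^bsub>F\<^esub> (e x y \<oplus>\<^bsub>F\<^esub> e x y') | x y y'.
          x \<in> carrier M \<and> y \<in> carrier N \<and> y' \<in> carrier N} \<union>
      {e (c \<odot>\<^bsub>M\<^esub> x) y \<ominus>\<^bsub>F\<^esub> (c \<odot>\<^bsub>F\<^esub> e x y) | c x y.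
          c \<in> carrier R \<and> x \<in> carrier M \<and> y \<in> carrier N} \<union>
      {e x (c \<odot>\<^bsub>N\<^esub> y) \<ominus>\<^bsub>F\<^esub> (c \<odot>\<^bsub>F\<^esub> e x y) | c x y.
          c \<in> carrier R \<and> x \<in> carrier M \<and> y \<in> carrier N})"

definition tensor_kernel ::
  "('k, 'r) ring_scheme \<Rightarrow> ('k, 'm, 'u) module_scheme \<Rightarrow> ('k, 'n, 'v) module_scheme \<Rightarrow>
   ('m \<times> 'n \<Rightarrow> 'k) set"
  where "tensor_kernel R M N =
    generated_submodule R (free_module R (carrier M \<times> carrier N)) (bilinear_relators R M N)"

definition tensor_module ::
  "('k, 'r) ring_scheme \<Rightarrow> ('k, 'm, 'u) module_scheme \<Rightarrow> ('k, 'n, 'v) module_scheme \<Rightarrow>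
   ('k, ('m \<times> 'n \<Rightarrow> 'k) set) module"
  where "tensor_module R M N =
    quotient_module (free_module R (carrier M \<times> carrier N)) (tensor_kernel R M N)"

definition pure_tensor ::
  "('k, 'r) ring_scheme \<Rightarrow> ('k, 'm, 'u) module_scheme \<Rightarrow> ('k, 'n, 'v) module_scheme \<Rightarrow>
   'm \<Rightarrow> 'n \<Rightarrow> ('m \<times> 'n \<Rightarrow> 'k) set"
  where "pure_tensor R M N x y =
    tensor_kernel R M N +>\<^bsub>free_module R (carrier M \<times> carrier N)\<^esub> free_gen R (x, y)"

text \<open>
  For bilinear \<open>\<beta>\<close> with values in \<open>P\<close>, \<open>tensor_lift R P \<beta>\<close> is the unique linear map on \<open>M \<otimes> N\<close>
  with \<open>x \<otimes> y \<mapsto> \<beta> x y\<close>: it evaluates \<open>\<beta>\<close> on any representative \<open>f\<close>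
  (a formal finite linear combination of pairs) of a coset.  See \<open>tensor_lift_pure\<close>,
  \<open>tensor_lift_linear\<close> and \<open>tensor_lift_unique\<close> below.
\<close>

definition free_eval ::
  "('k, 'r) ring_scheme \<Rightarrow> ('k, 'p, 'w) module_scheme \<Rightarrow> ('m \<Rightarrow> 'n \<Rightarrow> 'p) \<Rightarrow> ('m \<times> 'n \<Rightarrow> 'k) \<Rightarrow> 'p"
  where "free_eval R P \<beta> f =
    (\<Oplus>\<^bsub>P\<^esub>p\<in>{p. f p \<noteq> \<zero>\<^bsub>R\<^esub>}. f p \<odot>\<^bsub>P\<^esub> \<beta> (fst p) (snd p))"

definition tensor_lift ::
  "('k, 'r) ring_scheme \<Rightarrow> ('k, 'p, 'w) module_scheme \<Rightarrow> ('m \<Rightarrow> 'n \<Rightarrow> 'p) \<Rightarrow>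
   ('m \<times> 'n \<Rightarrow> 'k) set \<Rightarrow> 'p"
  where "tensor_lift R P \<beta> X = free_eval R P \<beta> (SOME f. f \<in> X)"

subsection \<open>Universal property\<close>

lemma free_module_simps [simp]:
  "zero (free_module R X) = (\<lambda>x. \<zero>\<^bsub>R\<^esub>)"
  "add (free_module R X) = (\<lambda>f g x. f x \<oplus>\<^bsub>R\<^esub> g x)"
  "smult (free_module R X) = (\<lambda>c f x. c \<otimes>\<^bsub>R\<^esub> f x)"
  by (simp_all add: free_module_def)

lemma free_moduleD:
  assumes "f \<in> carrier (free_module R X)"
  shows "f x \<in> carrier R" "{x. f x \<noteq> \<zero>\<^bsub>R\<^esub>} \<subseteq> X" "finite {x. f x \<noteq> \<zero>\<^bsub>R\<^esub>}"
  using assms by (auto simp: free_module_def)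

lemma (in cring) free_module_closed:
  assumes f: "f \<in> carrier (free_module R X)" and g: "g \<in> carrier (free_module R X)"
    and c: "c \<in> carrier R"
  shows "(\<lambda>x. f x \<oplus> g x) \<in> carrier (free_module R X)"
    and "(\<lambda>x. c \<otimes> f x) \<in> carrier (free_module R X)"
proof -
  have "{x. f x \<oplus> g x \<noteq> \<zero>} \<subseteq> {x. f x \<noteq> \<zero>} \<union> {x. g x \<noteq> \<zero>}" by auto
  then have "finite {x. f x \<oplus> g x \<noteq> \<zero>}"
    using free_moduleD(3)[OF f] free_moduleD(3)[OF g] by (meson finite_Un finite_subset)
  then show "(\<lambda>x. f x \<oplus> g x) \<in> carrier (free_module R X)"
    using f g by (auto simp: free_module_def)
  have "{x. c \<otimes> f x \<noteq> \<zero>} \<subseteq> {x. f x \<noteq> \<zero>}" using c by auto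
  then have "finite {x. c \<otimes> f x \<noteq> \<zero>}"
    using free_moduleD(3)[OF f] by (meson finite_subset)
  then show "(\<lambda>x. c \<otimes> f x) \<in> carrier (free_module R X)"
    using f c by (auto simp: free_module_def)
qed

lemma (in cring) free_module_is_module: "module R (free_module R X)"
proof (rule moduleI)
  show "cring R" by (rule is_cring)
  show "abelian_group (free_module R X)"
  proof (rule abelian_groupI)
    fix f assume f: "f \<in> carrier (free_module R X)"
    have "(\<lambda>x. (\<ominus> \<one>) \<otimes> f x) \<in> carrier (free_module R X)"
      using free_module_closed(2)[OF f f] by simp
    moreover have "(\<lambda>x. (\<ominus> \<one>) \<otimes> f x) \<oplus>\<^bsub>free_module R X\<^esub> f = \<zero>\<^bsub>free_module R X\<^esub>"
      using free_moduleD(1)[OF f] by (auto simp: fun_eq_iff l_minus l_neg)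
    ultimately show "\<exists>g\<in>carrier (free_module R X). g \<oplus>\<^bsub>free_module R X\<^esub> f = \<zero>\<^bsub>free_module R X\<^esub>"
      by blast
  next
    fix f g assume "f \<in> carrier (free_module R X)" "g \<in> carrier (free_module R X)"
    then show "f \<oplus>\<^bsub>free_module R X\<^esub> g \<in> carrier (free_module R X)"
      using free_module_closed(1)[of f X g \<zero>] by simp
  qed (auto simp: free_module_def a_ac fun_eq_iff)
next
  fix c f assume "c \<in> carrier R" "f \<in> carrier (free_module R X)"
  then show "c \<odot>\<^bsub>free_module R X\<^esub> f \<in> carrier (free_module R X)"
    using free_module_closed(2)[of f X f c] by simp
qed (auto simp: free_module_def l_distr r_distr m_assoc)

lemma (in cring) free_gen_closed [simp]:
  assumes "x \<in> X" shows "free_gen R x \<in> carrier (free_module R X)"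
proof -
  have "{y. free_gen R x y \<noteq> \<zero>} \<subseteq> {x}" by (auto simp: free_gen_def)
  then have "finite {y. free_gen R x y \<noteq> \<zero>}" by (rule finite_subset) simp
  with assms show ?thesis by (auto simp: free_module_def free_gen_def)
qed

lemma (in module) generated_submodule:
  assumes "S \<subseteq> carrier M"
  shows "submodule (generated_submodule R M S) R M" "S \<subseteq> generated_submodule R M S"
proof -
  show "submodule (generated_submodule R M S) R M"
  proof (rule submoduleI)
    show "generated_submodule R M S \<subseteq> carrier M"
      unfolding generated_submodule_def using carrier_is_submodule assms by blast
    show "\<zero>\<^bsub>M\<^esub> \<in> generated_submodule R M S"
      unfolding generated_submodule_def
      by (auto dest!: submodule.axioms(1) subgroup.one_closed)
  qed (auto simp: generated_submodule_def dest: submoduleE)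
  show "S \<subseteq> generated_submodule R M S"
    unfolding generated_submodule_def by blast
qed

lemma generated_submodule_least:
  assumes "submodule H R M" "S \<subseteq> H"
  shows "generated_submodule R M S \<subseteq> H"
  using assms unfolding generated_submodule_def by blast

lemma (in module) submodule_imp_abelian_subgroup:
  assumes "submodule H R M" shows "abelian_subgroup H M"
  by (meson M.abelian_group_axioms abelian_subgroupI3 additive_subgroupI assms submodule.axioms(1))

lemma (in module) quotient_smult:
  assumes H: "submodule H R M" and c: "c \<in> carrier R" and x: "x \<in> carrier M"
  shows "c \<odot>\<^bsub>quotient_module M H\<^esub> (H +>\<^bsub>M\<^esub> x) = H +>\<^bsub>M\<^esub> (c \<odot>\<^bsub>M\<^esub> x)"
proof -
  interpret H: abelian_subgroup H M by (rule submodule_imp_abelian_subgroup[OF H])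
  have indep: "H +>\<^bsub>M\<^esub> (c \<odot>\<^bsub>M\<^esub> y) = H +>\<^bsub>M\<^esub> (c \<odot>\<^bsub>M\<^esub> x)" if "y \<in> H +>\<^bsub>M\<^esub> x" for y
  proof -
    from that obtain h where h: "h \<in> H" "y = h \<oplus>\<^bsub>M\<^esub> x" by (auto simp: a_r_coset_def')
    have hM: "h \<in> carrier M" using h(1) H.a_subset by blast
    have "c \<odot>\<^bsub>M\<^esub> y = c \<odot>\<^bsub>M\<^esub> h \<oplus>\<^bsub>M\<^esub> c \<odot>\<^bsub>M\<^esub> x" using h hM c x by (simp add: smult_r_distr)
    moreover have "c \<odot>\<^bsub>M\<^esub> h \<in> H" using submoduleE(4)[OF H c h(1)] .
    ultimately have "c \<odot>\<^bsub>M\<^esub> y \<in> H +>\<^bsub>M\<^esub> (c \<odot>\<^bsub>M\<^esub> x)" by (auto simp: a_r_coset_def')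
    then show ?thesis
      using M.a_repr_independence[of "c \<odot>\<^bsub>M\<^esub> y" H "c \<odot>\<^bsub>M\<^esub> x"] c x H.a_subgroup by simp
  qed
  have "(\<Union>y\<in>H +>\<^bsub>M\<^esub> x. H +>\<^bsub>M\<^esub> (c \<odot>\<^bsub>M\<^esub> y)) = H +>\<^bsub>M\<^esub> (c \<odot>\<^bsub>M\<^esub> x)"
    using indep H.a_rcos_self[OF x] by blast
  then show ?thesis by (simp add: quotient_module_def)
qed

lemma (in module) quotient_is_module:
  assumes H: "submodule H R M"
  shows "module R (quotient_module M H)"
proof -
  let ?Q = "quotient_module M H"
  interpret H: abelian_subgroup H M by (rule submodule_imp_abelian_subgroup[OF H])
  have rep: "\<exists>x\<in>carrier M. X = H +>\<^bsub>M\<^esub> x" if "X \<in> carrier ?Q" for X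
    using that by (auto simp: quotient_module_def A_RCOSETS_def')
  have mem: "H +>\<^bsub>M\<^esub> x \<in> carrier ?Q" if "x \<in> carrier M" for x
    using that H.a_subset by (simp add: quotient_module_def M.a_rcosetsI)
  have plus: "(H +>\<^bsub>M\<^esub> x) \<oplus>\<^bsub>?Q\<^esub> (H +>\<^bsub>M\<^esub> y) = H +>\<^bsub>M\<^esub> (x \<oplus>\<^bsub>M\<^esub> y)"
    if "x \<in> carrier M" "y \<in> carrier M" for x y
    using that by (simp add: quotient_module_def H.a_rcos_sum)
  have zeroQ: "\<zero>\<^bsub>?Q\<^esub> = H +>\<^bsub>M\<^esub> \<zero>\<^bsub>M\<^esub>"
    using H.a_subset by (simp add: quotient_module_def)
  show ?thesis
  proof (rule moduleI)
    show "cring R" by (rule R.is_cring)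
    show "abelian_group ?Q"
    proof (rule abelian_groupI)
      fix X assume "X \<in> carrier ?Q"
      then obtain x where x: "x \<in> carrier M" "X = H +>\<^bsub>M\<^esub> x" using rep by blast
      have "(H +>\<^bsub>M\<^esub> (\<ominus>\<^bsub>M\<^esub> x)) \<oplus>\<^bsub>?Q\<^esub> X = \<zero>\<^bsub>?Q\<^esub>"
        using x by (simp add: plus zeroQ M.l_neg)
      then show "\<exists>Y\<in>carrier ?Q. Y \<oplus>\<^bsub>?Q\<^esub> X = \<zero>\<^bsub>?Q\<^esub>" using x mem by blast
    qed (auto dest!: rep simp: mem plus zeroQ M.a_ac)
  qed (auto dest!: rep simp: mem plus quotient_smult[OF H] smult_l_distr smult_r_distr smult_assoc1)
qed

locale tensor_pair = M: module R M + N: module R N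
  for R (structure) and M (structure) and N (structure)
begin

abbreviation "F \<equiv> free_module R (carrier M \<times> carrier N)"
abbreviation "K \<equiv> tensor_kernel R M N"
abbreviation "T \<equiv> tensor_module R M N"
abbreviation ptensor (infixl \<open>\<star>\<close> 75) where "x \<star> y \<equiv> pure_tensor R M N x y"

sublocale F: module R F by (rule M.free_module_is_module)

lemma bilinear_relators_subset: "bilinear_relators R M N \<subseteq> carrier F"
  unfolding bilinear_relators_def Let_def
  by (auto simp del: free_module_simps intro!: F.M.minus_closed F.M.a_closed F.smult_closed)

lemma tensor_kernel_submodule: "submodule K R F"
  unfolding tensor_kernel_def by (rule F.generated_submodule(1)[OF bilinear_relators_subset])

lemma bilinear_relators_in_kernel: "bilinear_relators R M N \<subseteq> K"
  unfolding tensor_kernel_def by (rule F.generated_submodule(2)[OF bilinear_relators_subset])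

sublocale K: abelian_subgroup K F
  by (rule F.submodule_imp_abelian_subgroup[OF tensor_kernel_submodule])

lemma tensor_is_module: "module R T"
  unfolding tensor_module_def by (rule F.quotient_is_module[OF tensor_kernel_submodule])

sublocale T: module R T by (rule tensor_is_module)

lemma class_closed: "f \<in> carrier F \<Longrightarrow> K +>\<^bsub>F\<^esub> f \<in> carrier T"
  using K.a_subset by (simp add: tensor_module_def quotient_module_def F.M.a_rcosetsI)

lemma class_add:
  "f \<in> carrier F \<Longrightarrow> g \<in> carrier F \<Longrightarrow>
   (K +>\<^bsub>F\<^esub> f) \<oplus>\<^bsub>T\<^esub> (K +>\<^bsub>F\<^esub> g) = K +>\<^bsub>F\<^esub> (f \<oplus>\<^bsub>F\<^esub> g)"
  by (simp add: tensor_module_def quotient_module_def K.a_rcos_sum del: free_module_simps)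

lemma class_smult:
  "c \<in> carrier R \<Longrightarrow> f \<in> carrier F \<Longrightarrow> c \<odot>\<^bsub>T\<^esub> (K +>\<^bsub>F\<^esub> f) = K +>\<^bsub>F\<^esub> (c \<odot>\<^bsub>F\<^esub> f)"
  unfolding tensor_module_def by (rule F.quotient_smult[OF tensor_kernel_submodule])

lemma class_cases:
  assumes "w \<in> carrier T" obtains f where "f \<in> carrier F" "w = K +>\<^bsub>F\<^esub> f"
  using assms by (auto simp: tensor_module_def quotient_module_def A_RCOSETS_def')

lemma class_eqI:
  assumes "f \<in> carrier F" "g \<in> carrier F" "f \<ominus>\<^bsub>F\<^esub> g \<in> K"
  shows "K +>\<^bsub>F\<^esub> f = K +>\<^bsub>F\<^esub> g"
proof -
  have "f = (f \<ominus>\<^bsub>F\<^esub> g) \<oplus>\<^bsub>F\<^esub> g"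
    using assms(1,2) by (simp add: F.M.minus_eq F.M.a_assoc F.M.l_neg del: free_module_simps)
  then have "f \<in> K +>\<^bsub>F\<^esub> g"
    unfolding a_r_coset_def' using assms(3) by blast
  then show ?thesis using F.M.a_repr_independence[of f K g] assms(2) K.a_subgroup by blast
qed

lemma pure_closed [simp, intro]:
  "x \<in> carrier M \<Longrightarrow> y \<in> carrier N \<Longrightarrow> x \<star> y \<in> carrier T"
  unfolding pure_tensor_def by (rule class_closed) simp

lemma pure_relation:
  assumes "f \<ominus>\<^bsub>F\<^esub> g \<in> bilinear_relators R M N" "f \<in> carrier F" "g \<in> carrier F"
  shows "K +>\<^bsub>F\<^esub> f = K +>\<^bsub>F\<^esub> g"
  using class_eqI assms bilinear_relators_in_kernel by blast

lemma pure_bilinear: "pure_tensor R M N \<in> bilinear_maps R M N T"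
proof -
  have e: "free_gen R (x, y) \<in> carrier F" if "x \<in> carrier M" "y \<in> carrier N" for x y
    using that by simp
  have 1: "(x \<oplus>\<^bsub>M\<^esub> x') \<star> y = x \<star> y \<oplus>\<^bsub>T\<^esub> x' \<star> y"
    if "x \<in> carrier M" "x' \<in> carrier M" "y \<in> carrier N" for x x' y
    unfolding pure_tensor_def class_add[OF e[OF that(1,3)] e[OF that(2,3)]]
    apply (rule pure_relation)
      apply (use that in \<open>unfold bilinear_relators_def Let_def, blast\<close>)
     apply (use that in \<open>blast intro: e M.a_closed N.a_closed M.smult_closed N.smult_closed\<close>)
    apply (use that in \<open>blast intro: e F.M.a_closed F.smult_closed\<close>)
    done
  have 2: "x \<star> (y \<oplus>\<^bsub>N\<^esub> y') = x \<star> y \<oplus>\<^bsub>T\<^esub> x \<star> y'"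
    if "x \<in> carrier M" "y \<in> carrier N" "y' \<in> carrier N" for x y y'
    unfolding pure_tensor_def class_add[OF e[OF that(1,2)] e[OF that(1,3)]]
    apply (rule pure_relation)
      apply (use that in \<open>unfold bilinear_relators_def Let_def, blast\<close>)
     apply (use that in \<open>blast intro: e M.a_closed N.a_closed M.smult_closed N.smult_closed\<close>)
    apply (use that in \<open>blast intro: e F.M.a_closed F.smult_closed\<close>)
    done
  have 3: "(c \<odot>\<^bsub>M\<^esub> x) \<star> y = c \<odot>\<^bsub>T\<^esub> x \<star> y"
    if "c \<in> carrier R" "x \<in> carrier M" "y \<in> carrier N" for c x y
    unfolding pure_tensor_def class_smult[OF that(1) e[OF that(2,3)]]
    apply (rule pure_relation)
      apply (use that in \<open>unfold bilinear_relators_def Let_def, blast\<close>)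
     apply (use that in \<open>blast intro: e M.a_closed N.a_closed M.smult_closed N.smult_closed\<close>)
    apply (use that in \<open>blast intro: e F.M.a_closed F.smult_closed\<close>)
    done
  have 4: "x \<star> (c \<odot>\<^bsub>N\<^esub> y) = c \<odot>\<^bsub>T\<^esub> x \<star> y"
    if "c \<in> carrier R" "x \<in> carrier M" "y \<in> carrier N" for c x y
    unfolding pure_tensor_def class_smult[OF that(1) e[OF that(2,3)]]
    apply (rule pure_relation)
      apply (use that in \<open>unfold bilinear_relators_def Let_def, blast\<close>)
     apply (use that in \<open>blast intro: e M.a_closed N.a_closed M.smult_closed N.smult_closed\<close>)
    apply (use that in \<open>blast intro: e F.M.a_closed F.smult_closed\<close>)
    done
  show ?thesis
    by (simp add: bilinear_maps_def linear_hom_def 1 2 3 4)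
qed

end

lemma linear_homD:
  assumes "f \<in> linear_hom R M N"
  shows "x \<in> carrier M \<Longrightarrow> f x \<in> carrier N"
    and "\<lbrakk>x \<in> carrier M; y \<in> carrier M\<rbrakk> \<Longrightarrow> f (x \<oplus>\<^bsub>M\<^esub> y) = f x \<oplus>\<^bsub>N\<^esub> f y"
    and "\<lbrakk>c \<in> carrier R; x \<in> carrier M\<rbrakk> \<Longrightarrow> f (c \<odot>\<^bsub>M\<^esub> x) = c \<odot>\<^bsub>N\<^esub> f x"
  using assms by (auto simp: linear_hom_def)

lemma linear_hom_zero_minus:
  assumes M: "module R M" and N: "module R N" and f: "f \<in> linear_hom R M N"
  shows "f \<zero>\<^bsub>M\<^esub> = \<zero>\<^bsub>N\<^esub>"
    and "x \<in> carrier M \<Longrightarrow> f (\<ominus>\<^bsub>M\<^esub> x) = \<ominus>\<^bsub>N\<^esub> f x"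
    and "\<lbrakk>x \<in> carrier M; y \<in> carrier M\<rbrakk> \<Longrightarrow> f (x \<ominus>\<^bsub>M\<^esub> y) = f x \<ominus>\<^bsub>N\<^esub> f y"
proof -
  interpret M: module R M by (rule M)
  interpret N: module R N by (rule N)
  note D = linear_homD[OF f]
  have "f (\<zero>\<^bsub>R\<^esub> \<odot>\<^bsub>M\<^esub> \<zero>\<^bsub>M\<^esub>) = \<zero>\<^bsub>R\<^esub> \<odot>\<^bsub>N\<^esub> f \<zero>\<^bsub>M\<^esub>" by (rule D(3)) simp_all
  then show z: "f \<zero>\<^bsub>M\<^esub> = \<zero>\<^bsub>N\<^esub>" using D(1)[OF M.M.zero_closed] by simp
  show m: "f (\<ominus>\<^bsub>M\<^esub> x) = \<ominus>\<^bsub>N\<^esub> f x" if x: "x \<in> carrier M" for x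
  proof -
    have "f (\<ominus>\<^bsub>M\<^esub> x) \<oplus>\<^bsub>N\<^esub> f x = \<zero>\<^bsub>N\<^esub>"
      using x D(2)[of "\<ominus>\<^bsub>M\<^esub> x" x] z by (simp add: M.M.l_neg)
    then show ?thesis using x D(1) by (simp add: N.M.minus_equality)
  qed
  show "f (x \<ominus>\<^bsub>M\<^esub> y) = f x \<ominus>\<^bsub>N\<^esub> f y" if "x \<in> carrier M" "y \<in> carrier M"
    using that by (simp add: a_minus_def D(2) m)
qed

locale tensor_bilinear = tensor_pair R M N + P: module R P
  for R (structure) and M (structure) and N (structure) and P (structure) +
  fixes \<beta>
  assumes bilinear: "\<beta> \<in> bilinear_maps R M N P"
begin

lemma \<beta>_left: "x \<in> carrier M \<Longrightarrow> \<beta> x \<in> linear_hom R N P"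
  and \<beta>_right: "y \<in> carrier N \<Longrightarrow> (\<lambda>x. \<beta> x y) \<in> linear_hom R M P"
  using bilinear by (auto simp: bilinear_maps_def)

lemma \<beta>_closed: "x \<in> carrier M \<Longrightarrow> y \<in> carrier N \<Longrightarrow> \<beta> x y \<in> carrier P"
  using linear_homD(1)[OF \<beta>_left] by blast

lemma term_closed:
  "f \<in> carrier F \<Longrightarrow> p \<in> carrier M \<times> carrier N \<Longrightarrow> f p \<odot>\<^bsub>P\<^esub> \<beta> (fst p) (snd p) \<in> carrier P"
  by (intro P.smult_closed \<beta>_closed free_moduleD(1)[of f]) auto

lemma free_eval_superset:
  assumes f: "f \<in> carrier F" and S: "finite S" "{p. f p \<noteq> \<zero>} \<subseteq> S" "S \<subseteq> carrier M \<times> carrier N"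
  shows "free_eval R P \<beta> f = (\<Oplus>\<^bsub>P\<^esub>p\<in>S. f p \<odot>\<^bsub>P\<^esub> \<beta> (fst p) (snd p))"
  unfolding free_eval_def
proof (rule P.M.add.finprod_mono_neutral_cong_left)
  show "(\<lambda>p. f p \<odot>\<^bsub>P\<^esub> \<beta> (fst p) (snd p)) \<in> S \<rightarrow> carrier P"
    using term_closed[OF f] S(3) by blast
  show "f p \<odot>\<^bsub>P\<^esub> \<beta> (fst p) (snd p) = \<zero>\<^bsub>P\<^esub>" if "p \<in> S - {p. f p \<noteq> \<zero>}" for p
    using that S(3) by (auto simp: \<beta>_closed)
qed (use S in auto)

lemma free_eval_linear: "free_eval R P \<beta> \<in> linear_hom R F P"
proof -
  have closed: "free_eval R P \<beta> f \<in> carrier P" if f: "f \<in> carrier F" for f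
    unfolding free_eval_def
    by (rule P.M.finsum_closed) (use term_closed[OF f] free_moduleD(2)[OF f] in blast)
  have add: "free_eval R P \<beta> (f \<oplus>\<^bsub>F\<^esub> g) = free_eval R P \<beta> f \<oplus>\<^bsub>P\<^esub> free_eval R P \<beta> g"
    if f: "f \<in> carrier F" and g: "g \<in> carrier F" for f g
  proof -
    let ?S = "{p. f p \<noteq> \<zero>} \<union> {p. g p \<noteq> \<zero>}"
    have S: "finite ?S" "?S \<subseteq> carrier M \<times> carrier N"
      using free_moduleD(2,3)[OF f] free_moduleD(2,3)[OF g] by auto
    have fg: "f \<oplus>\<^bsub>F\<^esub> g \<in> carrier F" using f g by (rule F.M.a_closed)
    have "free_eval R P \<beta> (f \<oplus>\<^bsub>F\<^esub> g) =
        (\<Oplus>\<^bsub>P\<^esub>p\<in>?S. (f p \<oplus> g p) \<odot>\<^bsub>P\<^esub> \<beta> (fst p) (snd p))"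
      by (subst free_eval_superset[OF fg S(1) _ S(2)]) auto
    also have "\<dots> = (\<Oplus>\<^bsub>P\<^esub>p\<in>?S. f p \<odot>\<^bsub>P\<^esub> \<beta> (fst p) (snd p) \<oplus>\<^bsub>P\<^esub> g p \<odot>\<^bsub>P\<^esub> \<beta> (fst p) (snd p))"
    proof (rule P.M.finsum_cong')
      show "(\<lambda>p. f p \<odot>\<^bsub>P\<^esub> \<beta> (fst p) (snd p) \<oplus>\<^bsub>P\<^esub> g p \<odot>\<^bsub>P\<^esub> \<beta> (fst p) (snd p)) \<in> ?S \<rightarrow> carrier P"
        using term_closed[OF f] term_closed[OF g] S(2) by (intro Pi_I P.M.a_closed) blast+
      show "(f p \<oplus> g p) \<odot>\<^bsub>P\<^esub> \<beta> (fst p) (snd p) =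
          f p \<odot>\<^bsub>P\<^esub> \<beta> (fst p) (snd p) \<oplus>\<^bsub>P\<^esub> g p \<odot>\<^bsub>P\<^esub> \<beta> (fst p) (snd p)" if "p \<in> ?S" for p
      proof (rule P.smult_l_distr)
        show "\<beta> (fst p) (snd p) \<in> carrier P" using that S(2) by (intro \<beta>_closed) auto
      qed (use free_moduleD(1)[OF f] free_moduleD(1)[OF g] in auto)
    qed simp
    also have "\<dots> = (\<Oplus>\<^bsub>P\<^esub>p\<in>?S. f p \<odot>\<^bsub>P\<^esub> \<beta> (fst p) (snd p)) \<oplus>\<^bsub>P\<^esub> (\<Oplus>\<^bsub>P\<^esub>p\<in>?S. g p \<odot>\<^bsub>P\<^esub> \<beta> (fst p) (snd p))"
      using term_closed[OF f] term_closed[OF g] S(2) by (intro P.M.finsum_addf) blast+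
    also have "\<dots> = free_eval R P \<beta> f \<oplus>\<^bsub>P\<^esub> free_eval R P \<beta> g"
      using free_eval_superset[OF f S(1) _ S(2)] free_eval_superset[OF g S(1) _ S(2)] by simp
    finally show ?thesis .
  qed
  have smult: "free_eval R P \<beta> (c \<odot>\<^bsub>F\<^esub> f) = c \<odot>\<^bsub>P\<^esub> free_eval R P \<beta> f"
    if c: "c \<in> carrier R" and f: "f \<in> carrier F" for c f
  proof -
    let ?S = "{p. f p \<noteq> \<zero>}"
    note S = free_moduleD(3)[OF f] free_moduleD(2)[OF f]
    have cf: "c \<odot>\<^bsub>F\<^esub> f \<in> carrier F" using c f by (rule F.smult_closed)
    have "free_eval R P \<beta> (c \<odot>\<^bsub>F\<^esub> f) =
        (\<Oplus>\<^bsub>P\<^esub>p\<in>?S. (c \<otimes> f p) \<odot>\<^bsub>P\<^esub> \<beta> (fst p) (snd p))"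
      using c by (subst free_eval_superset[OF cf S(1) _ S(2)]) auto
    also have "\<dots> = (\<Oplus>\<^bsub>P\<^esub>p\<in>?S. c \<odot>\<^bsub>P\<^esub> (f p \<odot>\<^bsub>P\<^esub> \<beta> (fst p) (snd p)))"
    proof (rule P.M.finsum_cong')
      show "(\<lambda>p. c \<odot>\<^bsub>P\<^esub> (f p \<odot>\<^bsub>P\<^esub> \<beta> (fst p) (snd p))) \<in> ?S \<rightarrow> carrier P"
        using c term_closed[OF f] S(2) by blast
      show "(c \<otimes> f p) \<odot>\<^bsub>P\<^esub> \<beta> (fst p) (snd p) = c \<odot>\<^bsub>P\<^esub> (f p \<odot>\<^bsub>P\<^esub> \<beta> (fst p) (snd p))"
        if "p \<in> ?S" for p
      proof (rule P.smult_assoc1)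
        show "\<beta> (fst p) (snd p) \<in> carrier P" using that S(2) by (intro \<beta>_closed) auto
      qed (use c free_moduleD(1)[OF f] in auto)
    qed simp
    also have "\<dots> = c \<odot>\<^bsub>P\<^esub> free_eval R P \<beta> f"
      unfolding free_eval_def using S c term_closed[OF f]
      by (intro P.finsum_smult_ldistr[symmetric]) blast+
    finally show ?thesis .
  qed
  show ?thesis unfolding linear_hom_def using closed add smult by blast
qed

lemma free_eval_gen:
  assumes x: "x \<in> carrier M" and y: "y \<in> carrier N"
  shows "free_eval R P \<beta> (free_gen R (x, y)) = \<beta> x y"
proof -
  have "free_eval R P \<beta> (free_gen R (x, y)) =
      (\<Oplus>\<^bsub>P\<^esub>p\<in>{(x, y)}. free_gen R (x, y) p \<odot>\<^bsub>P\<^esub> \<beta> (fst p) (snd p))"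
    using x y by (intro free_eval_superset M.R.free_gen_closed) (auto simp: free_gen_def)
  also have "\<dots> = \<beta> x y"
    using \<beta>_closed[OF x y] by (simp add: free_gen_def P.M.finsum_insert)
  finally show ?thesis .
qed

lemma free_eval_kernel:
  assumes "f \<in> K" shows "free_eval R P \<beta> f = \<zero>\<^bsub>P\<^esub>"
proof -
  let ?H = "{f \<in> carrier F. free_eval R P \<beta> f = \<zero>\<^bsub>P\<^esub>}"
  note D = linear_homD[OF free_eval_linear]
  note Z = linear_hom_zero_minus[OF F.module_axioms P.module_axioms free_eval_linear]
  have e: "free_gen R (x, y) \<in> carrier F" if "x \<in> carrier M" "y \<in> carrier N" for x y
    using that by simp
  have "submodule ?H R F"
    by (rule F.submoduleI) (auto simp: D Z simp del: free_module_simps)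
  moreover have "bilinear_relators R M N \<subseteq> ?H"
  proof
    fix g assume g: "g \<in> bilinear_relators R M N"
    then have gF: "g \<in> carrier F" using bilinear_relators_subset by blast
    have "free_eval R P \<beta> g = \<zero>\<^bsub>P\<^esub>"
      using g unfolding bilinear_relators_def Let_def
      by (auto simp: D Z e free_eval_gen \<beta>_closed P.M.r_neg a_minus_def[of P]
          linear_homD(2,3)[OF \<beta>_left] linear_homD(2,3)[OF \<beta>_right] simp del: free_module_simps)
    with gF show "g \<in> ?H" by blast
  qed
  ultimately have "K \<subseteq> ?H" unfolding tensor_kernel_def by (rule generated_submodule_least)
  with assms show ?thesis by blast
qed

lemma tensor_lift_class:
  assumes f: "f \<in> carrier F"
  shows "tensor_lift R P \<beta> (K +>\<^bsub>F\<^esub> f) = free_eval R P \<beta> f"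
proof -
  have "(SOME g. g \<in> K +>\<^bsub>F\<^esub> f) \<in> K +>\<^bsub>F\<^esub> f"
    by (rule someI[of "\<lambda>g. g \<in> K +>\<^bsub>F\<^esub> f", OF K.a_rcos_self[OF f]])
  then obtain k where k: "k \<in> K" "(SOME g. g \<in> K +>\<^bsub>F\<^esub> f) = k \<oplus>\<^bsub>F\<^esub> f"
    unfolding a_r_coset_def' by blast
  have kF: "k \<in> carrier F" using k(1) K.a_subset by blast
  show ?thesis
    unfolding tensor_lift_def k(2)
    using linear_homD(1,2)[OF free_eval_linear] free_eval_kernel[OF k(1)] kF f
    by (simp del: free_module_simps)
qed

lemma tensor_lift_linear: "tensor_lift R P \<beta> \<in> linear_hom R T P"
proof -
  note D = linear_homD[OF free_eval_linear]
  show ?thesis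
    unfolding linear_hom_def
    by (auto elim!: class_cases simp: class_add class_smult tensor_lift_class D simp del: free_module_simps)
qed

lemma tensor_lift_pure:
  "x \<in> carrier M \<Longrightarrow> y \<in> carrier N \<Longrightarrow> tensor_lift R P \<beta> (x \<star> y) = \<beta> x y"
  unfolding pure_tensor_def by (simp add: tensor_lift_class free_eval_gen)

end

lemma (in cring) free_module_induct [consumes 1, case_names zero gen add smult]:
  assumes f: "f \<in> carrier (free_module R X)"
    and zero: "Q (\<lambda>x. \<zero>)"
    and gen: "\<And>x. x \<in> X \<Longrightarrow> Q (free_gen R x)"
    and add: "\<And>f g. \<lbrakk>f \<in> carrier (free_module R X); g \<in> carrier (free_module R X); Q f; Q g\<rbrakk>
      \<Longrightarrow> Q (\<lambda>x. f x \<oplus> g x)"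
    and smult: "\<And>c f. \<lbrakk>c \<in> carrier R; f \<in> carrier (free_module R X); Q f\<rbrakk> \<Longrightarrow> Q (\<lambda>x. c \<otimes> f x)"
  shows "Q f"
proof -
  have "\<forall>f\<in>carrier (free_module R X). {x. f x \<noteq> \<zero>} \<subseteq> S \<longrightarrow> Q f" if "finite S" for S
    using that
  proof (induction S)
    case empty
    have "f = (\<lambda>x. \<zero>)" if "{x. f x \<noteq> \<zero>} \<subseteq> {}" for f using that by auto
    with zero show ?case by blast
  next
    case (insert a S)
    show ?case
    proof (intro ballI impI)
      fix f assume f: "f \<in> carrier (free_module R X)" and S: "{x. f x \<noteq> \<zero>} \<subseteq> insert a S"
      show "Q f"
      proof (cases "a \<in> X")
        case False
        then have "f a = \<zero>" using f by (auto simp: free_module_def)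
        then show ?thesis using S f insert.IH by blast
      next
        case True
        let ?g = "\<lambda>x. if x = a then \<zero> else f x" and ?h = "\<lambda>x. f a \<otimes> free_gen R a x"
        have "{x. ?g x \<noteq> \<zero>} \<subseteq> {x. f x \<noteq> \<zero>}" by auto
        then have "finite {x. ?g x \<noteq> \<zero>}" using free_moduleD(3)[OF f] finite_subset by blast
        then have g: "?g \<in> carrier (free_module R X)" using f by (auto simp: free_module_def)
        have h: "?h \<in> carrier (free_module R X)"
          using free_module_closed(2)[OF f free_gen_closed[OF True]]
            free_module_closed(2)[OF free_gen_closed[OF True] f free_moduleD(1)[OF f]] by blast
        have "{x. ?g x \<noteq> \<zero>} \<subseteq> S" using S by auto
        then have "Q ?g" by (rule insert.IH[THEN bspec, OF g, THEN mp])
        moreover have "Q ?h"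
          using True free_moduleD(1)[OF f] by (intro smult gen free_gen_closed)
        ultimately have "Q (\<lambda>x. ?g x \<oplus> ?h x)" using g h by (intro add)
        also have "(\<lambda>x. ?g x \<oplus> ?h x) = f"
          using free_moduleD(1)[OF f] by (auto simp: free_gen_def fun_eq_iff)
        finally show ?thesis .
      qed
    qed
  qed
  from this[OF free_moduleD(3)[OF f]] f show ?thesis by blast
qed

context tensor_pair
begin

lemma tensor_induct [consumes 1, case_names pure add smult]:
  assumes w: "w \<in> carrier T"
    and pure: "\<And>x y. \<lbrakk>x \<in> carrier M; y \<in> carrier N\<rbrakk> \<Longrightarrow> Q (x \<star> y)"
    and add: "\<And>w z. \<lbrakk>w \<in> carrier T; z \<in> carrier T; Q w; Q z\<rbrakk> \<Longrightarrow> Q (w \<oplus>\<^bsub>T\<^esub> z)"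
    and smult: "\<And>c w. \<lbrakk>c \<in> carrier R; w \<in> carrier T; Q w\<rbrakk> \<Longrightarrow> Q (c \<odot>\<^bsub>T\<^esub> w)"
  shows "Q w"
proof -
  obtain f where f: "f \<in> carrier F" "w = K +>\<^bsub>F\<^esub> f" using w by (rule class_cases)
  from f(1) have "Q (K +>\<^bsub>F\<^esub> f)"
  proof (induction f rule: M.R.free_module_induct)
    case zero
    have "Q (\<zero> \<odot>\<^bsub>T\<^esub> (\<zero>\<^bsub>M\<^esub> \<star> \<zero>\<^bsub>N\<^esub>))" by (intro smult pure pure_closed) auto
    moreover have "\<zero> \<odot>\<^bsub>T\<^esub> (\<zero>\<^bsub>M\<^esub> \<star> \<zero>\<^bsub>N\<^esub>) = K +>\<^bsub>F\<^esub> \<zero>\<^bsub>F\<^esub>"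
      using T.smult_l_null[OF pure_closed[OF M.M.zero_closed N.M.zero_closed]] K.a_subset
      by (simp add: tensor_module_def quotient_module_def del: free_module_simps)
    ultimately show ?case by simp
  next
    case (gen p)
    then show ?case using pure[of "fst p" "snd p"] by (auto simp: pure_tensor_def)
  next
    case (add f g)
    then show ?case using assms(3)[of "K +>\<^bsub>F\<^esub> f" "K +>\<^bsub>F\<^esub> g"] class_closed class_add[of f g] by simp
  next
    case (smult c f)
    then show ?case using assms(4)[of c "K +>\<^bsub>F\<^esub> f"] class_closed class_smult[of c f] by simp
  qed
  with f(2) show ?thesis by simp
qed

end

lemma (in tensor_bilinear) tensor_lift_unique:
  assumes \<phi>: "\<phi> \<in> linear_hom R T P"
    and pure: "\<And>x y. \<lbrakk>x \<in> carrier M; y \<in> carrier N\<rbrakk> \<Longrightarrow> \<phi> (x \<star> y) = \<beta> x y"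
    and w: "w \<in> carrier T"
  shows "\<phi> w = tensor_lift R P \<beta> w"
  using w
  by (induction w rule: tensor_induct)
    (simp_all add: pure tensor_lift_pure linear_homD[OF \<phi>] linear_homD[OF tensor_lift_linear])


section \<open>Tensor products of maps and of algebras\<close>

text \<open>\<open>f \<otimes> g : M \<otimes> N \<rightarrow> M' \<otimes> N'\<close>; the arguments \<open>M\<close>, \<open>N\<close> below are the codomains \<open>M'\<close>, \<open>N'\<close>.\<close>

definition tensor_map ::
  "('k, 'r) ring_scheme \<Rightarrow> ('k, 'm, 'u) module_scheme \<Rightarrow> ('k, 'n, 'v) module_scheme \<Rightarrow>
   ('a \<Rightarrow> 'm) \<Rightarrow> ('b \<Rightarrow> 'n) \<Rightarrow> ('a \<times> 'b \<Rightarrow> 'k) set \<Rightarrow> ('m \<times> 'n \<Rightarrow> 'k) set"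
  where "tensor_map R M N f g =
    tensor_lift R (tensor_module R M N) (\<lambda>x y. pure_tensor R M N (f x) (g y))"

text \<open>Componentwise product \<open>(a \<otimes> b)(a' \<otimes> b') = aa' \<otimes> bb'\<close>, extended bilinearly.\<close>

definition tensor_algebra ::
  "('k, 'r) ring_scheme \<Rightarrow> ('k, 'a, 'u) module_scheme \<Rightarrow> ('k, 'b, 'v) module_scheme \<Rightarrow>
   ('k, ('a \<times> 'b \<Rightarrow> 'k) set) module"
  where "tensor_algebra R A B = (tensor_module R A B)
    \<lparr>mult := (\<lambda>w z. tensor_lift R (tensor_module R A B)
        (\<lambda>a b. tensor_lift R (tensor_module R A B)
          (\<lambda>a' b'. pure_tensor R A B (a \<otimes>\<^bsub>A\<^esub> a') (b \<otimes>\<^bsub>B\<^esub> b')) z) w),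
     one := pure_tensor R A B \<one>\<^bsub>A\<^esub> \<one>\<^bsub>B\<^esub>\<rparr>"


section \<open>\<open>A \<otimes> A\<close> and \<open>A \<otimes> A \<otimes> A\<close>\<close>

text \<open>\<open>A \<otimes> A \<otimes> A\<close> is realised as \<open>(A \<otimes> A) \<otimes> A\<close>.\<close>

abbreviation tensor2 ::
  "('k, 'r) ring_scheme \<Rightarrow> ('k, 'a, 'u) module_scheme \<Rightarrow> ('k, ('a \<times> 'a \<Rightarrow> 'k) set) module"
  where "tensor2 R A \<equiv> tensor_algebra R A A"

abbreviation tensor3 ::
  "('k, 'r) ring_scheme \<Rightarrow> ('k, 'a, 'u) module_scheme \<Rightarrow>
   ('k, (('a \<times> 'a \<Rightarrow> 'k) set \<times> 'a \<Rightarrow> 'k) set) module"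
  where "tensor3 R A \<equiv> tensor_algebra R (tensor2 R A) A"

abbreviation pure2 ::
  "('k, 'r) ring_scheme \<Rightarrow> ('k, 'a, 'u) module_scheme \<Rightarrow> 'a \<Rightarrow> 'a \<Rightarrow> ('a \<times> 'a \<Rightarrow> 'k) set"
  where "pure2 R A a b \<equiv> pure_tensor R A A a b"

abbreviation pure3 ::
  "('k, 'r) ring_scheme \<Rightarrow> ('k, 'a, 'u) module_scheme \<Rightarrow> 'a \<Rightarrow> 'a \<Rightarrow> 'a \<Rightarrow>
   (('a \<times> 'a \<Rightarrow> 'k) set \<times> 'a \<Rightarrow> 'k) set"
  where "pure3 R A a b c \<equiv> pure_tensor R (tensor2 R A) A (pure2 R A a b) c"

text \<open>The canonical isomorphism \<open>A \<otimes> (A \<otimes> A) \<rightarrow> (A \<otimes> A) \<otimes> A\<close>.\<close>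

definition tensor_assoc ::
  "('k, 'r) ring_scheme \<Rightarrow> ('k, 'a, 'u) module_scheme \<Rightarrow>
   ('a \<times> ('a \<times> 'a \<Rightarrow> 'k) set \<Rightarrow> 'k) set \<Rightarrow> (('a \<times> 'a \<Rightarrow> 'k) set \<times> 'a \<Rightarrow> 'k) set"
  where "tensor_assoc R A =
    tensor_lift R (tensor3 R A) (\<lambda>a. tensor_lift R (tensor3 R A) (\<lambda>b c. pure3 R A a b c))"

text \<open>
  The outer bimodule actions, i.e. the linear extensions of \<open>a \<cdot> (b \<otimes> c) = ab \<otimes> c\<close>,
  \<open>(b \<otimes> c) \<cdot> a = b \<otimes> ca\<close>, and likewise on three factors.
\<close>

definition left_act2 ::
  "('k, 'r) ring_scheme \<Rightarrow> ('k, 'a, 'u) module_scheme \<Rightarrow> 'a \<Rightarrow>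
   ('a \<times> 'a \<Rightarrow> 'k) set \<Rightarrow> ('a \<times> 'a \<Rightarrow> 'k) set"
  where "left_act2 R A a = tensor_map R A A (\<lambda>b. a \<otimes>\<^bsub>A\<^esub> b) (\<lambda>c. c)"

definition right_act2 ::
  "('k, 'r) ring_scheme \<Rightarrow> ('k, 'a, 'u) module_scheme \<Rightarrow>
   ('a \<times> 'a \<Rightarrow> 'k) set \<Rightarrow> 'a \<Rightarrow> ('a \<times> 'a \<Rightarrow> 'k) set"
  where "right_act2 R A w a = tensor_map R A A (\<lambda>b. b) (\<lambda>c. c \<otimes>\<^bsub>A\<^esub> a) w"

definition left_act3 ::
  "('k, 'r) ring_scheme \<Rightarrow> ('k, 'a, 'u) module_scheme \<Rightarrow> 'a \<Rightarrow>
   (('a \<times> 'a \<Rightarrow> 'k) set \<times> 'a \<Rightarrow> 'k) set \<Rightarrow> (('a \<times> 'a \<Rightarrow> 'k) set \<times> 'a \<Rightarrow> 'k) set"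
  where "left_act3 R A a = tensor_map R (tensor2 R A) A (left_act2 R A a) (\<lambda>d. d)"

definition right_act3 ::
  "('k, 'r) ring_scheme \<Rightarrow> ('k, 'a, 'u) module_scheme \<Rightarrow>
   (('a \<times> 'a \<Rightarrow> 'k) set \<times> 'a \<Rightarrow> 'k) set \<Rightarrow> 'a \<Rightarrow> (('a \<times> 'a \<Rightarrow> 'k) set \<times> 'a \<Rightarrow> 'k) set"
  where "right_act3 R A w a = tensor_map R (tensor2 R A) A (\<lambda>w. w) (\<lambda>d. d \<otimes>\<^bsub>A\<^esub> a) w"

definition bimodule_invariant ::
  "('k, 'a, 'u) module_scheme \<Rightarrow> ('a \<Rightarrow> 'w \<Rightarrow> 'w) \<Rightarrow> ('w \<Rightarrow> 'a \<Rightarrow> 'w) \<Rightarrow> 'w \<Rightarrow> bool"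
  where "bimodule_invariant A lact ract w \<longleftrightarrow> (\<forall>a\<in>carrier A. lact a w = ract w a)"

definition leg12 ::
  "('k, 'r) ring_scheme \<Rightarrow> ('k, 'a, 'u) module_scheme \<Rightarrow>
   ('a \<times> 'a \<Rightarrow> 'k) set \<Rightarrow> (('a \<times> 'a \<Rightarrow> 'k) set \<times> 'a \<Rightarrow> 'k) set"
  where "leg12 R A = tensor_lift R (tensor3 R A) (\<lambda>u v. pure3 R A u v \<one>\<^bsub>A\<^esub>)"

definition leg13 ::
  "('k, 'r) ring_scheme \<Rightarrow> ('k, 'a, 'u) module_scheme \<Rightarrow>
   ('a \<times> 'a \<Rightarrow> 'k) set \<Rightarrow> (('a \<times> 'a \<Rightarrow> 'k) set \<times> 'a \<Rightarrow> 'k) set"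
  where "leg13 R A = tensor_lift R (tensor3 R A) (\<lambda>u v. pure3 R A u \<one>\<^bsub>A\<^esub> v)"

definition leg23 ::
  "('k, 'r) ring_scheme \<Rightarrow> ('k, 'a, 'u) module_scheme \<Rightarrow>
   ('a \<times> 'a \<Rightarrow> 'k) set \<Rightarrow> (('a \<times> 'a \<Rightarrow> 'k) set \<times> 'a \<Rightarrow> 'k) set"
  where "leg23 R A = tensor_lift R (tensor3 R A) (\<lambda>u v. pure3 R A \<one>\<^bsub>A\<^esub> u v)"


section \<open>The coproduct \<open>\<Delta>\<^sub>r\<close> and coassociativity\<close>

definition coproduct ::
  "('k, 'r) ring_scheme \<Rightarrow> ('k, 'a, 'u) module_scheme \<Rightarrow> 'k \<Rightarrow> ('a \<times> 'a \<Rightarrow> 'k) set \<Rightarrow>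
   'a \<Rightarrow> ('a \<times> 'a \<Rightarrow> 'k) set"
  where "coproduct R A lam r a =
    left_act2 R A a r \<ominus>\<^bsub>tensor2 R A\<^esub> right_act2 R A r a
      \<ominus>\<^bsub>tensor2 R A\<^esub> lam \<odot>\<^bsub>tensor2 R A\<^esub> pure2 R A a \<one>\<^bsub>A\<^esub>"

definition coassociative ::
  "('k, 'r) ring_scheme \<Rightarrow> ('k, 'a, 'u) module_scheme \<Rightarrow> ('a \<Rightarrow> ('a \<times> 'a \<Rightarrow> 'k) set) \<Rightarrow> bool"
  where "coassociative R A \<Delta> \<longleftrightarrow>
    (\<forall>a\<in>carrier A.
       tensor_map R (tensor2 R A) A \<Delta> (\<lambda>x. x) (\<Delta> a) =
       tensor_assoc R A (tensor_map R A (tensor2 R A) (\<lambda>x. x) \<Delta> (\<Delta> a)))"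

definition yang_baxter_element ::
  "('k, 'r) ring_scheme \<Rightarrow> ('k, 'a, 'u) module_scheme \<Rightarrow> 'k \<Rightarrow> ('a \<times> 'a \<Rightarrow> 'k) set \<Rightarrow>
   (('a \<times> 'a \<Rightarrow> 'k) set \<times> 'a \<Rightarrow> 'k) set"
  where "yang_baxter_element R A lam r =
    (let T = tensor3 R A; r12 = leg12 R A r; r13 = leg13 R A r; r23 = leg23 R A r in
      r13 \<otimes>\<^bsub>T\<^esub> r12 \<ominus>\<^bsub>T\<^esub> r12 \<otimes>\<^bsub>T\<^esub> r23 \<oplus>\<^bsub>T\<^esub> r23 \<otimes>\<^bsub>T\<^esub> r13 \<ominus>\<^bsub>T\<^esub> lam \<odot>\<^bsub>T\<^esub> r13)"

end

theory Submission
  imports Defs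
begin

text \<open>
  For \<open>w \<in> A \<otimes> A\<close> one checks on pure tensors that
  \<open>(\<Delta>\<^sub>r \<otimes> id) w = w\<^sub>1\<^sub>3 r\<^sub>1\<^sub>2 - r\<^sub>1\<^sub>2 w\<^sub>2\<^sub>3 - \<lambda> w\<^sub>1\<^sub>3\<close> and
  \<open>(id \<otimes> \<Delta>\<^sub>r) w = w\<^sub>1\<^sub>2 r\<^sub>2\<^sub>3 - r\<^sub>2\<^sub>3 w\<^sub>1\<^sub>3 - \<lambda> w\<^sub>1\<^sub>2\<close>.  For \<open>w = \<Delta>\<^sub>r(a)\<close> the legs of \<open>w\<close> are
  expressed by those of \<open>r\<close> and by \<open>a\<^sub>1 = a \<otimes> 1 \<otimes> 1\<close>, \<open>a\<^sub>2\<close>, \<open>a\<^sub>3\<close>; since \<open>a\<^sub>3\<close> commutes with \<open>r\<^sub>1\<^sub>2\<close>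
  and \<open>a\<^sub>1\<close> with \<open>r\<^sub>2\<^sub>3\<close>, a computation in the ring \<open>A \<otimes> A \<otimes> A\<close> shows that the difference of the two
  expressions is \<open>a\<^sub>1 Y - Y a\<^sub>3 = a \<cdot> Y - Y \<cdot> a\<close> for the Yang-Baxter element \<open>Y\<close>.
\<close>

section \<open>Linear and bilinear maps\<close>

lemma linear_homI:
  assumes "\<And>x. x \<in> carrier M \<Longrightarrow> f x \<in> carrier N"
    and "\<And>x y. \<lbrakk>x \<in> carrier M; y \<in> carrier M\<rbrakk> \<Longrightarrow> f (x \<oplus>\<^bsub>M\<^esub> y) = f x \<oplus>\<^bsub>N\<^esub> f y"
    and "\<And>c x. \<lbrakk>c \<in> carrier R; x \<in> carrier M\<rbrakk> \<Longrightarrow> f (c \<odot>\<^bsub>M\<^esub> x) = c \<odot>\<^bsub>N\<^esub> f x"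
  shows "f \<in> linear_hom R M N"
  using assms by (auto simp: linear_hom_def)

lemma linear_hom_id: "(\<lambda>x. x) \<in> linear_hom R M M"
  by (rule linear_homI) simp_all

lemma linear_hom_compose:
  assumes "g \<in> linear_hom R N P" "f \<in> linear_hom R M N"
  shows "(\<lambda>x. g (f x)) \<in> linear_hom R M P"
  using linear_homD[OF assms(1)] linear_homD[OF assms(2)] by (intro linear_homI) simp_all

lemma (in module) linear_hom_smult:
  assumes f: "f \<in> linear_hom R N M" and c: "c \<in> carrier R"
  shows "(\<lambda>x. c \<odot>\<^bsub>M\<^esub> f x) \<in> linear_hom R N M"
proof (rule linear_homI)
  fix d x assume "d \<in> carrier R" "x \<in> carrier N"
  then show "c \<odot>\<^bsub>M\<^esub> f (d \<odot>\<^bsub>N\<^esub> x) = d \<odot>\<^bsub>M\<^esub> (c \<odot>\<^bsub>M\<^esub> f x)"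
    using c linear_homD[OF f] by (simp add: smult_assoc1[symmetric] R.m_comm)
qed (use c linear_homD[OF f] in \<open>simp_all add: smult_r_distr\<close>)

lemma (in module) linear_hom_minus:
  assumes f: "f \<in> linear_hom R N M" and g: "g \<in> linear_hom R N M"
  shows "(\<lambda>x. f x \<ominus>\<^bsub>M\<^esub> g x) \<in> linear_hom R N M"
proof (rule linear_homI)
  fix x y assume "x \<in> carrier N" "y \<in> carrier N"
  then show "f (x \<oplus>\<^bsub>N\<^esub> y) \<ominus>\<^bsub>M\<^esub> g (x \<oplus>\<^bsub>N\<^esub> y) = (f x \<ominus>\<^bsub>M\<^esub> g x) \<oplus>\<^bsub>M\<^esub> (f y \<ominus>\<^bsub>M\<^esub> g y)"
    using linear_homD[OF f] linear_homD[OF g] by (simp add: M.minus_eq M.minus_add M.a_ac)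
qed (use linear_homD[OF f] linear_homD[OF g] in
    \<open>simp_all add: M.minus_eq smult_r_distr smult_r_minus\<close>)

lemma bilinear_mapsI:
  assumes "\<And>x. x \<in> carrier M \<Longrightarrow> \<beta> x \<in> linear_hom R N P"
    and "\<And>y. y \<in> carrier N \<Longrightarrow> (\<lambda>x. \<beta> x y) \<in> linear_hom R M P"
  shows "\<beta> \<in> bilinear_maps R M N P"
  using assms by (auto simp: bilinear_maps_def)

lemma bilinear_mapsD:
  assumes "\<beta> \<in> bilinear_maps R M N P"
  shows "x \<in> carrier M \<Longrightarrow> \<beta> x \<in> linear_hom R N P"
    and "y \<in> carrier N \<Longrightarrow> (\<lambda>x. \<beta> x y) \<in> linear_hom R M P"
  using assms by (auto simp: bilinear_maps_def)

lemma bilinear_maps_compose: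
  assumes \<beta>: "\<beta> \<in> bilinear_maps R M N P"
    and f: "f \<in> linear_hom R M' M" and g: "g \<in> linear_hom R N' N"
  shows "(\<lambda>x y. \<beta> (f x) (g y)) \<in> bilinear_maps R M' N' P"
proof (rule bilinear_mapsI)
  fix x assume "x \<in> carrier M'"
  then show "(\<lambda>y. \<beta> (f x) (g y)) \<in> linear_hom R N' P"
    by (intro linear_hom_compose[OF _ g] bilinear_mapsD[OF \<beta>] linear_homD(1)[OF f])
next
  fix y assume "y \<in> carrier N'"
  then show "(\<lambda>x. \<beta> (f x) (g y)) \<in> linear_hom R M' P"
    by (intro linear_hom_compose[OF _ f] bilinear_mapsD(2)[OF \<beta>] linear_homD(1)[OF g])
qed

lemma linear_hom_bilinear_compose:
  assumes "\<phi> \<in> linear_hom R P Q" "\<beta> \<in> bilinear_maps R M N P"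
  shows "(\<lambda>x y. \<phi> (\<beta> x y)) \<in> bilinear_maps R M N Q"
  by (intro bilinear_mapsI linear_hom_compose[OF assms(1)] bilinear_mapsD[OF assms(2)])

section \<open>Extensionality on tensor products, and lifts that depend on a parameter\<close>

lemma (in tensor_pair) tensor_linear_ext:
  assumes \<phi>: "\<phi> \<in> linear_hom R T P" and \<psi>: "\<psi> \<in> linear_hom R T P"
    and pure: "\<And>x y. \<lbrakk>x \<in> carrier M; y \<in> carrier N\<rbrakk> \<Longrightarrow> \<phi> (x \<star> y) = \<psi> (x \<star> y)"
    and w: "w \<in> carrier T"
  shows "\<phi> w = \<psi> w"
  using w by (induction w rule: tensor_induct) (simp_all add: pure linear_homD[OF \<phi>] linear_homD[OF \<psi>])

text \<open>Needed wherever one lift is nested in another, as in the product of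
  \<open>tensor_algebra\<close> and in \<open>tensor_assoc\<close>. Induction on \<open>w\<close>
  reduces linearity in \<open>q\<close> to pure tensors, where it is \<open>\<beta>_param\<close>;
  the scalar case uses commutativity of \<open>R\<close>.\<close>

lemma (in tensor_pair) tensor_lift_parameter:
  assumes P: "module R P"
    and \<beta>: "\<And>q. q \<in> carrier Q \<Longrightarrow> \<beta> q \<in> bilinear_maps R M N P"
    and \<beta>_param: "\<And>x y. \<lbrakk>x \<in> carrier M; y \<in> carrier N\<rbrakk> \<Longrightarrow> (\<lambda>q. \<beta> q x y) \<in> linear_hom R Q P"
    and Q: "module R Q"
    and w: "w \<in> carrier T"
  shows "(\<lambda>q. tensor_lift R P (\<beta> q) w) \<in> linear_hom R Q P"
proof -
  interpret P: module R P by (rule P)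
  interpret Q: module R Q by (rule Q)
  have bil: "tensor_bilinear R M N P (\<beta> q)" if "q \<in> carrier Q" for q
    using \<beta>[OF that] by unfold_locales
  note lin = tensor_bilinear.tensor_lift_linear[OF bil]
  note lin' = linear_homD[OF lin]
  show ?thesis
    using w
  proof (induction w rule: tensor_induct)
    case (pure x y)
    then show ?case
      using linear_homD[OF \<beta>_param[of x y]]
      by (intro linear_homI) (simp_all add: tensor_bilinear.tensor_lift_pure[OF bil])
  next
    case (add w z)
    then show ?case
      using linear_homD[OF add(3)] linear_homD[OF add(4)]
      by (intro linear_homI) (simp_all add: lin' P.M.a_ac P.smult_r_distr)
  next
    case (smult c w)
    then show ?case
      using linear_homD[OF smult(3)]
      by (intro linear_homI)
        (simp_all add: lin' P.smult_r_distr P.smult_assoc1[symmetric] M.R.m_comm)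
  qed
qed


section \<open>The tensor product of unital algebras\<close>

lemma (in unital_algebra) mult_bilinear: "(\<lambda>x y. x \<otimes>\<^bsub>A\<^esub> y) \<in> bilinear_maps R A A A"
  by (intro bilinear_mapsI linear_homI)
    (simp_all add: A.l_distr A.r_distr smult_mult_left smult_mult_right)

lemma tensor_algebra_simps:
  "carrier (tensor_algebra R A B) = carrier (tensor_module R A B)"
  "zero (tensor_algebra R A B) = zero (tensor_module R A B)"
  "add (tensor_algebra R A B) = add (tensor_module R A B)"
  "smult (tensor_algebra R A B) = smult (tensor_module R A B)"
  "one (tensor_algebra R A B) = pure_tensor R A B \<one>\<^bsub>A\<^esub> \<one>\<^bsub>B\<^esub>"
  "linear_hom R' M (tensor_algebra R A B) = linear_hom R' M (tensor_module R A B)"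
  "linear_hom R' (tensor_algebra R A B) M = linear_hom R' (tensor_module R A B) M"
  "bilinear_maps R' M N (tensor_algebra R A B) = bilinear_maps R' M N (tensor_module R A B)"
  by (simp_all add: tensor_algebra_def linear_hom_def bilinear_maps_def)

text \<open>A lift sees its target only through \<open>smult\<close> and \<open>finsum\<close>,
  hence through the module structure, while \<open>tensor_algebra\<close> changes only
  \<open>mult\<close> and \<open>one\<close>. Unfolding down to \<open>finsum_def\<close> makes this
  visible.\<close>

lemma tensor_lift_tensor_algebra:
  "tensor_lift R' (tensor_algebra R A B) = tensor_lift R' (tensor_module R A B)"
  by (simp add: fun_eq_iff tensor_lift_def free_eval_def finsum_def tensor_algebra_def)

text \<open>The two factors may differ, so that the same results serve \<open>A \<otimes> A\<close>,
  \<open>(A \<otimes> A) \<otimes> A\<close> and \<open>A \<otimes> (A \<otimes> A)\<close>.\<close>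

locale unital_algebra_pair = A: unital_algebra R A + B: unital_algebra R B
  for R (structure) and A (structure) and B (structure)
begin

abbreviation "TA \<equiv> tensor_algebra R A B"
abbreviation ptensor (infixl \<open>\<star>\<close> 75) where "x \<star> y \<equiv> pure_tensor R A B x y"

lemma tensor_pair: "tensor_pair R A B"
  by unfold_locales

lemma tensor_algebra_is_module: "module R TA"
proof -
  interpret T: module R "tensor_module R A B"
    by (rule tensor_pair.tensor_is_module[OF tensor_pair])
  have "\<exists>y\<in>carrier TA. y \<oplus>\<^bsub>TA\<^esub> x = \<zero>\<^bsub>TA\<^esub>" if "x \<in> carrier TA" for x
    using that T.M.l_neg[of x] T.M.a_inv_closed[of x] unfolding tensor_algebra_simps by blast
  then have "abelian_group TA"
    by (intro abelian_groupI) (simp_all add: tensor_algebra_simps T.M.a_ac)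
  then show ?thesis
    by (intro moduleI)
      (simp_all add: A.R.is_cring tensor_algebra_simps T.smult_l_distr T.smult_r_distr T.smult_assoc1)
qed

lemma pure_closed [simp, intro]: "x \<in> carrier A \<Longrightarrow> y \<in> carrier B \<Longrightarrow> x \<star> y \<in> carrier TA"
  using tensor_pair.pure_closed[OF tensor_pair] by (simp add: tensor_algebra_simps)

lemma pure_bilinear: "pure_tensor R A B \<in> bilinear_maps R A B TA"
  using tensor_pair.pure_bilinear[OF tensor_pair] by (simp add: tensor_algebra_simps)

lemma pure_linear_left:
  "y \<in> carrier B \<Longrightarrow> f \<in> linear_hom R M A \<Longrightarrow> (\<lambda>x. f x \<star> y) \<in> linear_hom R M TA"
  by (rule linear_hom_compose[OF bilinear_mapsD(2)[OF pure_bilinear]])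

lemma pure_linear_right:
  "x \<in> carrier A \<Longrightarrow> f \<in> linear_hom R M B \<Longrightarrow> (\<lambda>y. x \<star> f y) \<in> linear_hom R M TA"
  by (rule linear_hom_compose[OF bilinear_mapsD(1)[OF pure_bilinear]])

lemma tensor_ext:
  assumes "w \<in> carrier TA" "\<phi> \<in> linear_hom R TA P" "\<psi> \<in> linear_hom R TA P"
    and "\<And>x y. \<lbrakk>x \<in> carrier A; y \<in> carrier B\<rbrakk> \<Longrightarrow> \<phi> (x \<star> y) = \<psi> (x \<star> y)"
  shows "\<phi> w = \<psi> w"
  using assms by - (rule tensor_pair.tensor_linear_ext[OF tensor_pair], simp_all add: tensor_algebra_simps)

context
  fixes P and \<beta>
  assumes P: "module R P" and \<beta>: "\<beta> \<in> bilinear_maps R A B P"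
begin

lemma tensor_bilinear: "tensor_bilinear R A B P \<beta>"
  by (intro tensor_bilinear.intro tensor_bilinear_axioms.intro tensor_pair P \<beta>)

lemma lift_linear: "tensor_lift R P \<beta> \<in> linear_hom R TA P"
  using tensor_bilinear.tensor_lift_linear[OF tensor_bilinear] by (simp add: tensor_algebra_simps)

lemma lift_pure:
  "x \<in> carrier A \<Longrightarrow> y \<in> carrier B \<Longrightarrow> tensor_lift R P \<beta> (x \<star> y) = \<beta> x y"
  by (rule tensor_bilinear.tensor_lift_pure[OF tensor_bilinear])

end

lemma lift_parameter:
  assumes "module R P" "module R Q"
    and "\<And>q. q \<in> carrier Q \<Longrightarrow> \<beta> q \<in> bilinear_maps R A B P"
    and "\<And>x y. \<lbrakk>x \<in> carrier A; y \<in> carrier B\<rbrakk> \<Longrightarrow> (\<lambda>q. \<beta> q x y) \<in> linear_hom R Q P"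
    and "w \<in> carrier TA"
  shows "(\<lambda>q. tensor_lift R P (\<beta> q) w) \<in> linear_hom R Q P"
  using assms by - (rule tensor_pair.tensor_lift_parameter[OF tensor_pair], simp_all add: tensor_algebra_simps tensor_lift_tensor_algebra)

lemma tensor_map_pure:
  assumes "f \<in> linear_hom R M A" "g \<in> linear_hom R N B" "unital_algebra_pair R M N"
    "x \<in> carrier M" "y \<in> carrier N"
  shows "tensor_map R A B f g (pure_tensor R M N x y) = f x \<star> g y"
proof -
  interpret D: unital_algebra_pair R M N by fact
  show ?thesis
    unfolding tensor_map_def tensor_lift_tensor_algebra[symmetric]
    by (intro D.lift_pure tensor_algebra_is_module bilinear_maps_compose[OF pure_bilinear] assms)
qed

lemma tensor_map_linear:
  assumes "f \<in> linear_hom R M A" "g \<in> linear_hom R N B" "unital_algebra_pair R M N"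
  shows "tensor_map R A B f g \<in> linear_hom R (tensor_algebra R M N) TA"
proof -
  interpret D: unital_algebra_pair R M N by fact
  show ?thesis
    unfolding tensor_map_def tensor_lift_tensor_algebra[symmetric]
    by (intro D.lift_linear tensor_algebra_is_module bilinear_maps_compose[OF pure_bilinear] assms)
qed

section \<open>The componentwise product and the algebra laws\<close>

lemma mult_eq:
  "w \<otimes>\<^bsub>TA\<^esub> z = tensor_lift R TA (\<lambda>a b. tensor_lift R TA (\<lambda>a' b'. (a \<otimes>\<^bsub>A\<^esub> a') \<star> (b \<otimes>\<^bsub>B\<^esub> b')) z) w"
  unfolding tensor_lift_tensor_algebra by (simp add: tensor_algebra_def)

lemma pure_mult_bilinear:
  "a \<in> carrier A \<Longrightarrow> b \<in> carrier B \<Longrightarrow>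
   (\<lambda>a' b'. (a \<otimes>\<^bsub>A\<^esub> a') \<star> (b \<otimes>\<^bsub>B\<^esub> b')) \<in> bilinear_maps R A B TA"
  by (intro bilinear_maps_compose[OF pure_bilinear] bilinear_mapsD(1)[OF A.mult_bilinear]
      bilinear_mapsD(1)[OF B.mult_bilinear])

lemma pure_mult_bilinear':
  "a' \<in> carrier A \<Longrightarrow> b' \<in> carrier B \<Longrightarrow>
   (\<lambda>a b. (a \<otimes>\<^bsub>A\<^esub> a') \<star> (b \<otimes>\<^bsub>B\<^esub> b')) \<in> bilinear_maps R A B TA"
  by (intro bilinear_maps_compose[OF pure_bilinear] bilinear_mapsD(2)[OF A.mult_bilinear]
      bilinear_mapsD(2)[OF B.mult_bilinear])

text \<open>This makes the outer lift in \<open>mult_eq\<close> legitimate: for fixed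
  \<open>z\<close>, the inner lift depends linearly on each of its parameters \<open>a\<close> and
  \<open>b\<close>.\<close>

lemma tensor_mult_outer_bilinear:
  assumes z: "z \<in> carrier TA"
  shows "(\<lambda>a b. tensor_lift R TA (\<lambda>a' b'. (a \<otimes>\<^bsub>A\<^esub> a') \<star> (b \<otimes>\<^bsub>B\<^esub> b')) z)
    \<in> bilinear_maps R A B TA"
proof (rule bilinear_mapsI)
  fix a assume a: "a \<in> carrier A"
  show "(\<lambda>b. tensor_lift R TA (\<lambda>a' b'. (a \<otimes>\<^bsub>A\<^esub> a') \<star> (b \<otimes>\<^bsub>B\<^esub> b')) z) \<in> linear_hom R B TA"
    by (rule lift_parameter[OF tensor_algebra_is_module B.module_axioms])
      (use a z in \<open>auto intro: pure_mult_bilinear bilinear_mapsD(1)[OF pure_mult_bilinear']\<close>)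
next
  fix b assume b: "b \<in> carrier B"
  show "(\<lambda>a. tensor_lift R TA (\<lambda>a' b'. (a \<otimes>\<^bsub>A\<^esub> a') \<star> (b \<otimes>\<^bsub>B\<^esub> b')) z) \<in> linear_hom R A TA"
    by (rule lift_parameter[OF tensor_algebra_is_module A.module_axioms])
      (use b z in \<open>auto intro: pure_mult_bilinear bilinear_mapsD(2)[OF pure_mult_bilinear']\<close>)
qed

text \<open>The two arguments enter \<open>mult_eq\<close> differently: \<open>w\<close> is the
  argument of the outer lift, which is linear, whereas \<open>z\<close> is a parameter of it and
  calls for \<open>lift_parameter\<close>.\<close>

lemma tensor_mult_bilinear: "(\<lambda>w z. w \<otimes>\<^bsub>TA\<^esub> z) \<in> bilinear_maps R TA TA TA"
proof (rule bilinear_mapsI)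
  fix z assume z: "z \<in> carrier TA"
  show "(\<lambda>w. w \<otimes>\<^bsub>TA\<^esub> z) \<in> linear_hom R TA TA"
    unfolding mult_eq using lift_linear[OF tensor_algebra_is_module tensor_mult_outer_bilinear[OF z]]
    by simp
next
  fix w assume w: "w \<in> carrier TA"
  show "(\<lambda>z. w \<otimes>\<^bsub>TA\<^esub> z) \<in> linear_hom R TA TA"
    unfolding mult_eq
    by (rule lift_parameter[OF tensor_algebra_is_module tensor_algebra_is_module])
      (use w in \<open>auto intro: tensor_mult_outer_bilinear
         lift_linear[OF tensor_algebra_is_module pure_mult_bilinear]\<close>)
qed

lemma pure_mult:
  assumes "a \<in> carrier A" "b \<in> carrier B" "a' \<in> carrier A" "b' \<in> carrier B"
  shows "(a \<star> b) \<otimes>\<^bsub>TA\<^esub> (a' \<star> b') = (a \<otimes>\<^bsub>A\<^esub> a') \<star> (b \<otimes>\<^bsub>B\<^esub> b')"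
  using assms unfolding mult_eq
  by (simp add: lift_pure[OF tensor_algebra_is_module tensor_mult_outer_bilinear]
      lift_pure[OF tensor_algebra_is_module pure_mult_bilinear])

lemmas mult_linear_left = linear_hom_compose[OF bilinear_mapsD(2)[OF tensor_mult_bilinear]]
lemmas mult_linear_right = linear_hom_compose[OF bilinear_mapsD(1)[OF tensor_mult_bilinear]]

text \<open>Associativity and the unit laws are linear in each variable, so
  \<open>tensor_ext\<close>, applied to one variable at a time, reduces them to pure tensors, where
  they hold in each factor. Distributivity and the scalar laws are bilinearity of the
  product.\<close>

lemma tensor_algebra_unital: "unital_algebra R TA"
proof -
  note TM = tensor_algebra_is_module
  note mult_lin = linear_homD[OF bilinear_mapsD(1)[OF tensor_mult_bilinear]]
    linear_homD[OF bilinear_mapsD(2)[OF tensor_mult_bilinear]]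
  note lin = mult_linear_left mult_linear_right linear_hom_id
  interpret T: module R TA by (rule TM)
  have assoc: "w \<otimes>\<^bsub>TA\<^esub> y \<otimes>\<^bsub>TA\<^esub> z = w \<otimes>\<^bsub>TA\<^esub> (y \<otimes>\<^bsub>TA\<^esub> z)"
    if w: "w \<in> carrier TA" and y: "y \<in> carrier TA" and z: "z \<in> carrier TA" for w y z
  proof (rule tensor_ext[OF w])
    fix a b assume ab: "a \<in> carrier A" "b \<in> carrier B"
    show "(a \<star> b) \<otimes>\<^bsub>TA\<^esub> y \<otimes>\<^bsub>TA\<^esub> z = (a \<star> b) \<otimes>\<^bsub>TA\<^esub> (y \<otimes>\<^bsub>TA\<^esub> z)"
    proof (rule tensor_ext[OF y])
      fix c d assume cd: "c \<in> carrier A" "d \<in> carrier B"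
      show "(a \<star> b) \<otimes>\<^bsub>TA\<^esub> (c \<star> d) \<otimes>\<^bsub>TA\<^esub> z = (a \<star> b) \<otimes>\<^bsub>TA\<^esub> ((c \<star> d) \<otimes>\<^bsub>TA\<^esub> z)"
        by (rule tensor_ext[OF z])
          (use ab cd in \<open>auto intro!: lin mult_lin(1,4) simp: pure_mult A.A.m_assoc B.A.m_assoc\<close>)
    qed (use ab z in \<open>auto intro!: lin mult_lin(1,4)\<close>)
  qed (use y z in \<open>auto intro!: lin mult_lin(1,4)\<close>)
  have one: "\<one>\<^bsub>TA\<^esub> = \<one>\<^bsub>A\<^esub> \<star> \<one>\<^bsub>B\<^esub>" by (simp add: tensor_algebra_simps)
  have l_one: "\<one>\<^bsub>TA\<^esub> \<otimes>\<^bsub>TA\<^esub> w = w" if "w \<in> carrier TA" for w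
    using that unfolding one
    by (rule tensor_ext) (auto intro!: lin simp: pure_mult)
  have r_one: "w \<otimes>\<^bsub>TA\<^esub> \<one>\<^bsub>TA\<^esub> = w" if "w \<in> carrier TA" for w
    using that unfolding one
    by (rule tensor_ext) (auto intro!: lin simp: pure_mult)
  have "ring TA"
  proof (rule ringI)
    show "monoid TA"
      by (rule monoidI) (simp_all only: mult_lin(1) assoc l_one r_one, simp add: one)
  qed (simp_all only: T.M.abelian_group_axioms mult_lin)
  then show ?thesis
    by (intro unital_algebra.intro TM unital_algebra_axioms.intro) (simp_all only: mult_lin)
qed

sublocale TA: unital_algebra R TA by (rule tensor_algebra_unital)

end


section \<open>Coassociativity\<close>

lemma (in ring) coassoc_cancellation:
  assumes "p1 \<in> carrier R" "p2 \<in> carrier R" "q1 \<in> carrier R" "q2 \<in> carrier R"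
    "t \<in> carrier R" "v1 \<in> carrier R" "v2 \<in> carrier R" "c1 \<in> carrier R" "c2 \<in> carrier R"
    "d1 \<in> carrier R" "d2 \<in> carrier R" "f \<in> carrier R" "g \<in> carrier R"
  shows "(p1 \<ominus> p2 \<ominus> d1) \<ominus> (q1 \<ominus> q2 \<ominus> d2) \<ominus> (c1 \<ominus> c2 \<ominus> g) \<oplus> (p2 \<ominus> q2 \<oplus> v2 \<ominus> c2) =
    (t \<ominus> q1 \<ominus> f) \<ominus> (v1 \<ominus> v2 \<ominus> f) \<ominus> (d1 \<ominus> d2 \<ominus> g) \<oplus> (p1 \<ominus> t \<oplus> v1 \<ominus> c1)"
  \<comment> \<open>Each letter stands for one monomial of \<open>coassoc_difference\<close>, for
    instance \<open>p1\<close> for \<open>a1 r13 r12\<close>, \<open>t\<close> for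
    \<open>a1 r12 r23\<close> and \<open>f\<close> for \<open>l a1 r23\<close>. Only additive
    cancellation remains: both sides equal \<open>p1 - q1 + v2 - c1 - d1 + d2 + g\<close>.\<close>
  using assms by algebra

lemma (in ring) minus_distr:
  assumes "x \<in> carrier R" "y \<in> carrier R" "z \<in> carrier R"
  shows "(x \<ominus> y) \<otimes> z = x \<otimes> z \<ominus> y \<otimes> z" "z \<otimes> (x \<ominus> y) = z \<otimes> x \<ominus> z \<otimes> y"
  using assms by algebra+

lemma (in module) smult_minus_distr:
  assumes "c \<in> carrier R" "x \<in> carrier M" "y \<in> carrier M"
  shows "c \<odot>\<^bsub>M\<^esub> (x \<ominus>\<^bsub>M\<^esub> y) = c \<odot>\<^bsub>M\<^esub> x \<ominus>\<^bsub>M\<^esub> c \<odot>\<^bsub>M\<^esub> y"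
  using assms by (simp add: M.minus_eq smult_r_distr smult_r_minus)

context unital_algebra
begin

text \<open>
  Used with \<open>a1 = a \<otimes> 1 \<otimes> 1\<close>, \<open>a2 = 1 \<otimes> a \<otimes> 1\<close>, \<open>a3 = 1 \<otimes> 1 \<otimes> a\<close>, the legs \<open>rij\<close> of \<open>r\<close> and the
  legs \<open>dij\<close> of \<open>\<Delta>\<^sub>r(a)\<close>.
\<close>

lemma coassoc_difference:
  assumes l: "l \<in> carrier R"
    and a: "a1 \<in> carrier A" "a2 \<in> carrier A" "a3 \<in> carrier A"
    and r: "r12 \<in> carrier A" "r13 \<in> carrier A" "r23 \<in> carrier A"
    and c3: "a3 \<otimes>\<^bsub>A\<^esub> r12 = r12 \<otimes>\<^bsub>A\<^esub> a3" and c1: "r23 \<otimes>\<^bsub>A\<^esub> a1 = a1 \<otimes>\<^bsub>A\<^esub> r23"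
    and d12: "d12 = a1 \<otimes>\<^bsub>A\<^esub> r12 \<ominus>\<^bsub>A\<^esub> r12 \<otimes>\<^bsub>A\<^esub> a2 \<ominus>\<^bsub>A\<^esub> l \<odot>\<^bsub>A\<^esub> a1"
    and d13: "d13 = a1 \<otimes>\<^bsub>A\<^esub> r13 \<ominus>\<^bsub>A\<^esub> r13 \<otimes>\<^bsub>A\<^esub> a3 \<ominus>\<^bsub>A\<^esub> l \<odot>\<^bsub>A\<^esub> a1"
    and d23: "d23 = a2 \<otimes>\<^bsub>A\<^esub> r23 \<ominus>\<^bsub>A\<^esub> r23 \<otimes>\<^bsub>A\<^esub> a3 \<ominus>\<^bsub>A\<^esub> l \<odot>\<^bsub>A\<^esub> a2"
    and y: "y = r13 \<otimes>\<^bsub>A\<^esub> r12 \<ominus>\<^bsub>A\<^esub> r12 \<otimes>\<^bsub>A\<^esub> r23 \<oplus>\<^bsub>A\<^esub> r23 \<otimes>\<^bsub>A\<^esub> r13 \<ominus>\<^bsub>A\<^esub> l \<odot>\<^bsub>A\<^esub> r13"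
  shows "d13 \<otimes>\<^bsub>A\<^esub> r12 \<ominus>\<^bsub>A\<^esub> r12 \<otimes>\<^bsub>A\<^esub> d23 \<ominus>\<^bsub>A\<^esub> l \<odot>\<^bsub>A\<^esub> d13 \<oplus>\<^bsub>A\<^esub> y \<otimes>\<^bsub>A\<^esub> a3 =
    d12 \<otimes>\<^bsub>A\<^esub> r23 \<ominus>\<^bsub>A\<^esub> r23 \<otimes>\<^bsub>A\<^esub> d13 \<ominus>\<^bsub>A\<^esub> l \<odot>\<^bsub>A\<^esub> d12 \<oplus>\<^bsub>A\<^esub> a1 \<otimes>\<^bsub>A\<^esub> y"
proof -
  note simps = A.minus_distr A.l_distr A.r_distr smult_minus_distr smult_mult_left smult_mult_right
    A.m_assoc l a r
  \<comment> \<open>Once products are nested to the right, \<open>c1\<close> no longer matches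
    inside a longer product; this is its form with a further right factor.\<close>
  have c1': "r23 \<otimes>\<^bsub>A\<^esub> (a1 \<otimes>\<^bsub>A\<^esub> x) = a1 \<otimes>\<^bsub>A\<^esub> (r23 \<otimes>\<^bsub>A\<^esub> x)" if "x \<in> carrier A" for x
    using a r c1 that by (simp add: A.m_assoc[symmetric])
  \<comment> \<open>The eight expansions bring all terms to common monomials, with \<open>a1\<close>
    leftmost and \<open>a3\<close> rightmost. Commutation enters in \<open>1\<close>, moving
    \<open>a3\<close> past \<open>r12\<close>, and in \<open>6\<close>, moving \<open>a1\<close>
    past \<open>r23\<close>.\<close>
  have 1: "d13 \<otimes>\<^bsub>A\<^esub> r12 = a1 \<otimes>\<^bsub>A\<^esub> (r13 \<otimes>\<^bsub>A\<^esub> r12) \<ominus>\<^bsub>A\<^esub> r13 \<otimes>\<^bsub>A\<^esub> (r12 \<otimes>\<^bsub>A\<^esub> a3)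
      \<ominus>\<^bsub>A\<^esub> l \<odot>\<^bsub>A\<^esub> (a1 \<otimes>\<^bsub>A\<^esub> r12)"
    unfolding d13 by (simp add: simps c3)
  have 2: "r12 \<otimes>\<^bsub>A\<^esub> d23 = r12 \<otimes>\<^bsub>A\<^esub> (a2 \<otimes>\<^bsub>A\<^esub> r23) \<ominus>\<^bsub>A\<^esub> r12 \<otimes>\<^bsub>A\<^esub> (r23 \<otimes>\<^bsub>A\<^esub> a3)
      \<ominus>\<^bsub>A\<^esub> l \<odot>\<^bsub>A\<^esub> (r12 \<otimes>\<^bsub>A\<^esub> a2)"
    unfolding d23 by (simp add: simps)
  have 3: "l \<odot>\<^bsub>A\<^esub> d13 = l \<odot>\<^bsub>A\<^esub> (a1 \<otimes>\<^bsub>A\<^esub> r13) \<ominus>\<^bsub>A\<^esub> l \<odot>\<^bsub>A\<^esub> (r13 \<otimes>\<^bsub>A\<^esub> a3) \<ominus>\<^bsub>A\<^esub> l \<odot>\<^bsub>A\<^esub> (l \<odot>\<^bsub>A\<^esub> a1)"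
    unfolding d13 by (simp add: simps)
  have 4: "y \<otimes>\<^bsub>A\<^esub> a3 = r13 \<otimes>\<^bsub>A\<^esub> (r12 \<otimes>\<^bsub>A\<^esub> a3) \<ominus>\<^bsub>A\<^esub> r12 \<otimes>\<^bsub>A\<^esub> (r23 \<otimes>\<^bsub>A\<^esub> a3)
      \<oplus>\<^bsub>A\<^esub> r23 \<otimes>\<^bsub>A\<^esub> (r13 \<otimes>\<^bsub>A\<^esub> a3) \<ominus>\<^bsub>A\<^esub> l \<odot>\<^bsub>A\<^esub> (r13 \<otimes>\<^bsub>A\<^esub> a3)"
    unfolding y by (simp add: simps)
  have 5: "d12 \<otimes>\<^bsub>A\<^esub> r23 = a1 \<otimes>\<^bsub>A\<^esub> (r12 \<otimes>\<^bsub>A\<^esub> r23) \<ominus>\<^bsub>A\<^esub> r12 \<otimes>\<^bsub>A\<^esub> (a2 \<otimes>\<^bsub>A\<^esub> r23)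
      \<ominus>\<^bsub>A\<^esub> l \<odot>\<^bsub>A\<^esub> (a1 \<otimes>\<^bsub>A\<^esub> r23)"
    unfolding d12 by (simp add: simps)
  have 6: "r23 \<otimes>\<^bsub>A\<^esub> d13 = a1 \<otimes>\<^bsub>A\<^esub> (r23 \<otimes>\<^bsub>A\<^esub> r13) \<ominus>\<^bsub>A\<^esub> r23 \<otimes>\<^bsub>A\<^esub> (r13 \<otimes>\<^bsub>A\<^esub> a3)
      \<ominus>\<^bsub>A\<^esub> l \<odot>\<^bsub>A\<^esub> (a1 \<otimes>\<^bsub>A\<^esub> r23)"
    unfolding d13 by (simp add: simps c1 c1')
  have 7: "l \<odot>\<^bsub>A\<^esub> d12 = l \<odot>\<^bsub>A\<^esub> (a1 \<otimes>\<^bsub>A\<^esub> r12) \<ominus>\<^bsub>A\<^esub> l \<odot>\<^bsub>A\<^esub> (r12 \<otimes>\<^bsub>A\<^esub> a2) \<ominus>\<^bsub>A\<^esub> l \<odot>\<^bsub>A\<^esub> (l \<odot>\<^bsub>A\<^esub> a1)"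
    unfolding d12 by (simp add: simps)
  have 8: "a1 \<otimes>\<^bsub>A\<^esub> y = a1 \<otimes>\<^bsub>A\<^esub> (r13 \<otimes>\<^bsub>A\<^esub> r12) \<ominus>\<^bsub>A\<^esub> a1 \<otimes>\<^bsub>A\<^esub> (r12 \<otimes>\<^bsub>A\<^esub> r23)
      \<oplus>\<^bsub>A\<^esub> a1 \<otimes>\<^bsub>A\<^esub> (r23 \<otimes>\<^bsub>A\<^esub> r13) \<ominus>\<^bsub>A\<^esub> l \<odot>\<^bsub>A\<^esub> (a1 \<otimes>\<^bsub>A\<^esub> r13)"
    unfolding y by (simp add: simps)
  show ?thesis
    unfolding 1 2 3 4 5 6 7 8 by (rule A.coassoc_cancellation) (simp_all add: l a r)
qed

end

section \<open>The triple tensor product and its outer actions as multiplications\<close>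

locale tensor_cube = unital_algebra R A
  for R :: "('k, 'r) ring_scheme" (structure) and A :: "('k, 'a, 'u) module_scheme" (structure)
begin

abbreviation "T \<equiv> tensor2 R A"
abbreviation "U \<equiv> tensor3 R A"

text \<open>This instance comes first because it makes \<open>T\<close> a unital algebra, as the
  next two require. \<open>AT\<close> carries \<open>A \<otimes> (A \<otimes> A)\<close>, the
  codomain of \<open>id \<otimes> \<Delta>\<close> before reassociation.\<close>

sublocale T: unital_algebra_pair R A A by unfold_locales
sublocale U: unital_algebra_pair R T A by unfold_locales
sublocale AT: unital_algebra_pair R A T by unfold_locales

abbreviation pure_tensor2 (infixl \<open>\<bullet>\<close> 76) where "a \<bullet> b \<equiv> pure2 R A a b"
abbreviation pure_tensor3 (infixl \<open>\<star>\<close> 75) where "w \<star> c \<equiv> pure_tensor R T A w c"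

abbreviation "in1 a \<equiv> a \<bullet> \<one>\<^bsub>A\<^esub> \<star> \<one>\<^bsub>A\<^esub>"
abbreviation "in2 a \<equiv> \<one>\<^bsub>A\<^esub> \<bullet> a \<star> \<one>\<^bsub>A\<^esub>"
abbreviation "in3 a \<equiv> \<one>\<^bsub>A\<^esub> \<bullet> \<one>\<^bsub>A\<^esub> \<star> a"

lemmas T_module = T.tensor_algebra_is_module
lemmas U_module = U.tensor_algebra_is_module

lemmas linear_intros = T.mult_linear_left T.mult_linear_right U.mult_linear_left U.mult_linear_right
  T.pure_linear_left T.pure_linear_right U.pure_linear_left U.pure_linear_right
  linear_hom_id bilinear_mapsD[OF mult_bilinear]
  T.TA.linear_hom_minus U.TA.linear_hom_minus T.TA.linear_hom_smult U.TA.linear_hom_smult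

lemma left_act2_linear: "a \<in> carrier A \<Longrightarrow> left_act2 R A a \<in> linear_hom R T T"
  unfolding left_act2_def
  by (rule T.tensor_map_linear) (auto intro: linear_intros T.unital_algebra_pair_axioms)

lemma right_act2_linear: "a \<in> carrier A \<Longrightarrow> (\<lambda>w. right_act2 R A w a) \<in> linear_hom R T T"
  unfolding right_act2_def
  by (rule T.tensor_map_linear) (auto intro: linear_intros T.unital_algebra_pair_axioms)

text \<open>Replacing actions by products moves the whole argument into a ring. Both sides are
  linear in \<open>w\<close> and give \<open>ax \<otimes> y\<close> on
  \<open>x \<otimes> y\<close>.\<close>

lemma left_act2_eq:
  assumes a: "a \<in> carrier A" and w: "w \<in> carrier T"
  shows "left_act2 R A a w = (a \<bullet> \<one>\<^bsub>A\<^esub>) \<otimes>\<^bsub>T\<^esub> w"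
proof (rule T.tensor_ext[OF w left_act2_linear[OF a]])
  show "(\<lambda>w. (a \<bullet> \<one>\<^bsub>A\<^esub>) \<otimes>\<^bsub>T\<^esub> w) \<in> linear_hom R T T"
    using a by (intro linear_intros) auto
  show "left_act2 R A a (x \<bullet> y) = (a \<bullet> \<one>\<^bsub>A\<^esub>) \<otimes>\<^bsub>T\<^esub> (x \<bullet> y)"
    if "x \<in> carrier A" "y \<in> carrier A" for x y
    unfolding left_act2_def using a that
    by (subst T.tensor_map_pure[where M=A and N=A])
      (auto intro: linear_intros T.unital_algebra_pair_axioms simp: T.pure_mult)
qed

lemma right_act2_eq:
  assumes a: "a \<in> carrier A" and w: "w \<in> carrier T"
  shows "right_act2 R A w a = w \<otimes>\<^bsub>T\<^esub> (\<one>\<^bsub>A\<^esub> \<bullet> a)"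
proof (rule T.tensor_ext[OF w right_act2_linear[OF a]])
  show "(\<lambda>w. w \<otimes>\<^bsub>T\<^esub> (\<one>\<^bsub>A\<^esub> \<bullet> a)) \<in> linear_hom R T T"
    using a by (intro linear_intros) auto
  show "right_act2 R A (x \<bullet> y) a = (x \<bullet> y) \<otimes>\<^bsub>T\<^esub> (\<one>\<^bsub>A\<^esub> \<bullet> a)"
    if "x \<in> carrier A" "y \<in> carrier A" for x y
    unfolding right_act2_def using a that
    by (subst T.tensor_map_pure[where M=A and N=A])
      (auto intro: linear_intros T.unital_algebra_pair_axioms simp: T.pure_mult)
qed

lemma left_act3_eq:
  assumes a: "a \<in> carrier A" and w: "w \<in> carrier U"
  shows "left_act3 R A a w = in1 a \<otimes>\<^bsub>U\<^esub> w"
proof (rule U.tensor_ext[OF w])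
  show "left_act3 R A a \<in> linear_hom R U U"
    unfolding left_act3_def using a
    by (intro U.tensor_map_linear left_act2_linear linear_hom_id U.unital_algebra_pair_axioms)
  show "(\<lambda>w. in1 a \<otimes>\<^bsub>U\<^esub> w) \<in> linear_hom R U U"
    using a by (intro linear_intros) auto
  show "left_act3 R A a (x \<star> y) = in1 a \<otimes>\<^bsub>U\<^esub> (x \<star> y)"
    if "x \<in> carrier T" "y \<in> carrier A" for x y
    unfolding left_act3_def using a that
    by (subst U.tensor_map_pure[where M=T and N=A])
      (auto intro: linear_hom_id left_act2_linear U.unital_algebra_pair_axioms
        simp: U.pure_mult left_act2_eq)
qed

lemma right_act3_eq:
  assumes a: "a \<in> carrier A" and w: "w \<in> carrier U"
  shows "right_act3 R A w a = w \<otimes>\<^bsub>U\<^esub> in3 a"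
proof (rule U.tensor_ext[OF w])
  show "(\<lambda>w. right_act3 R A w a) \<in> linear_hom R U U"
    unfolding right_act3_def using a
    by (intro U.tensor_map_linear linear_intros U.unital_algebra_pair_axioms)
  show "(\<lambda>w. w \<otimes>\<^bsub>U\<^esub> in3 a) \<in> linear_hom R U U"
    using a by (intro linear_intros) auto
  \<comment> \<open>The unit of \<open>T\<close> occurs inside \<open>in3 a\<close> as the pure
    tensor \<open>1 \<otimes> 1\<close>, so the unit law is restated in that form.\<close>
  have "x \<otimes>\<^bsub>T\<^esub> (\<one>\<^bsub>A\<^esub> \<bullet> \<one>\<^bsub>A\<^esub>) = x" if "x \<in> carrier T" for x
    using T.TA.A.r_one[OF that] by (simp add: tensor_algebra_simps)
  then show "right_act3 R A (x \<star> y) a = (x \<star> y) \<otimes>\<^bsub>U\<^esub> in3 a"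
    if "x \<in> carrier T" "y \<in> carrier A" for x y
    unfolding right_act3_def using a that
    by (subst U.tensor_map_pure[where M=T and N=A])
      (auto intro: linear_intros U.unital_algebra_pair_axioms simp: U.pure_mult)
qed

section \<open>The leg maps and the associator\<close>

lemma leg12_bilinear: "(\<lambda>u v. pure3 R A u v \<one>\<^bsub>A\<^esub>) \<in> bilinear_maps R A A U"
  by (rule linear_hom_bilinear_compose[OF _ T.pure_bilinear]) (auto intro: linear_intros)

lemma leg13_bilinear: "(\<lambda>u v. pure3 R A u \<one>\<^bsub>A\<^esub> v) \<in> bilinear_maps R A A U"
  by (rule bilinear_maps_compose[OF U.pure_bilinear]) (auto intro: linear_intros)

lemma pure3_bilinear: "a \<in> carrier A \<Longrightarrow> (\<lambda>u v. pure3 R A a u v) \<in> bilinear_maps R A A U"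
  by (rule bilinear_maps_compose[OF U.pure_bilinear]) (auto intro: linear_intros)

lemmas leg23_bilinear = pure3_bilinear[OF A.one_closed]

lemma leg_linear:
  "leg12 R A \<in> linear_hom R T U" "leg13 R A \<in> linear_hom R T U" "leg23 R A \<in> linear_hom R T U"
  unfolding leg12_def leg13_def leg23_def
  by (intro T.lift_linear U_module leg12_bilinear leg13_bilinear leg23_bilinear)+

lemmas leg_closed [simp] = leg_linear[THEN linear_homD(1)]

lemma leg_pure:
  assumes "u \<in> carrier A" "v \<in> carrier A"
  shows "leg12 R A (u \<bullet> v) = u \<bullet> v \<star> \<one>\<^bsub>A\<^esub>"
    and "leg13 R A (u \<bullet> v) = u \<bullet> \<one>\<^bsub>A\<^esub> \<star> v"
    and "leg23 R A (u \<bullet> v) = \<one>\<^bsub>A\<^esub> \<bullet> u \<star> v"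
  unfolding leg12_def leg13_def leg23_def
  by (simp_all add: T.lift_pure[OF U_module] leg12_bilinear leg13_bilinear leg23_bilinear assms)

text \<open>In the bracketing \<open>(A \<otimes> A) \<otimes> A\<close> the 12-leg is a pure tensor
  over \<open>T\<close> even when \<open>w\<close> is not pure, so \<open>U.pure_mult\<close>
  computes products with the 12-leg of a general \<open>r\<close>.\<close>

lemma leg12_eq: "w \<in> carrier T \<Longrightarrow> leg12 R A w = w \<star> \<one>\<^bsub>A\<^esub>"
  by (rule T.tensor_ext[where P=U])
    (auto intro: linear_intros leg_linear simp: leg_pure)

text \<open>A leg map carries the two slots of \<open>w\<close> to the two positions in its name,
  and the product is componentwise, so a factor \<open>a\<close> acting on a slot becomes a factor
  in the corresponding position. Linearity in \<open>w\<close> reduces this to pure tensors.\<close>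

lemma leg_mult:
  assumes a: "a \<in> carrier A" and w: "w \<in> carrier T"
  shows "leg12 R A ((a \<bullet> \<one>\<^bsub>A\<^esub>) \<otimes>\<^bsub>T\<^esub> w) = in1 a \<otimes>\<^bsub>U\<^esub> leg12 R A w"
    and "leg12 R A (w \<otimes>\<^bsub>T\<^esub> (\<one>\<^bsub>A\<^esub> \<bullet> a)) = leg12 R A w \<otimes>\<^bsub>U\<^esub> in2 a"
    and "leg13 R A ((a \<bullet> \<one>\<^bsub>A\<^esub>) \<otimes>\<^bsub>T\<^esub> w) = in1 a \<otimes>\<^bsub>U\<^esub> leg13 R A w"
    and "leg13 R A (w \<otimes>\<^bsub>T\<^esub> (\<one>\<^bsub>A\<^esub> \<bullet> a)) = leg13 R A w \<otimes>\<^bsub>U\<^esub> in3 a"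
    and "leg23 R A ((a \<bullet> \<one>\<^bsub>A\<^esub>) \<otimes>\<^bsub>T\<^esub> w) = in2 a \<otimes>\<^bsub>U\<^esub> leg23 R A w"
    and "leg23 R A (w \<otimes>\<^bsub>T\<^esub> (\<one>\<^bsub>A\<^esub> \<bullet> a)) = leg23 R A w \<otimes>\<^bsub>U\<^esub> in3 a"
proof -
  note lin = linear_intros leg_linear leg_linear[THEN linear_hom_compose]
  note pure = leg_pure T.pure_mult U.pure_mult
  show "leg12 R A ((a \<bullet> \<one>\<^bsub>A\<^esub>) \<otimes>\<^bsub>T\<^esub> w) = in1 a \<otimes>\<^bsub>U\<^esub> leg12 R A w"
    by (rule T.tensor_ext[OF w, where P=U]; (intro lin)?) (simp_all add: a pure)
  show "leg12 R A (w \<otimes>\<^bsub>T\<^esub> (\<one>\<^bsub>A\<^esub> \<bullet> a)) = leg12 R A w \<otimes>\<^bsub>U\<^esub> in2 a"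
    by (rule T.tensor_ext[OF w, where P=U]; (intro lin)?) (simp_all add: a pure)
  show "leg13 R A ((a \<bullet> \<one>\<^bsub>A\<^esub>) \<otimes>\<^bsub>T\<^esub> w) = in1 a \<otimes>\<^bsub>U\<^esub> leg13 R A w"
    by (rule T.tensor_ext[OF w, where P=U]; (intro lin)?) (simp_all add: a pure)
  show "leg13 R A (w \<otimes>\<^bsub>T\<^esub> (\<one>\<^bsub>A\<^esub> \<bullet> a)) = leg13 R A w \<otimes>\<^bsub>U\<^esub> in3 a"
    by (rule T.tensor_ext[OF w, where P=U]; (intro lin)?) (simp_all add: a pure)
  show "leg23 R A ((a \<bullet> \<one>\<^bsub>A\<^esub>) \<otimes>\<^bsub>T\<^esub> w) = in2 a \<otimes>\<^bsub>U\<^esub> leg23 R A w"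
    by (rule T.tensor_ext[OF w, where P=U]; (intro lin)?) (simp_all add: a pure)
  show "leg23 R A (w \<otimes>\<^bsub>T\<^esub> (\<one>\<^bsub>A\<^esub> \<bullet> a)) = leg23 R A w \<otimes>\<^bsub>U\<^esub> in3 a"
    by (rule T.tensor_ext[OF w, where P=U]; (intro lin)?) (simp_all add: a pure)
qed

text \<open>Elements supported in disjoint tensor positions commute: each position meets at most one
  factor other than 1.\<close>

lemma leg_commute:
  assumes a: "a \<in> carrier A" and w: "w \<in> carrier T"
  shows "in3 a \<otimes>\<^bsub>U\<^esub> leg12 R A w = leg12 R A w \<otimes>\<^bsub>U\<^esub> in3 a"
    and "leg23 R A w \<otimes>\<^bsub>U\<^esub> in1 a = in1 a \<otimes>\<^bsub>U\<^esub> leg23 R A w"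
proof -
  note pure = leg_pure T.pure_mult U.pure_mult
  show "in3 a \<otimes>\<^bsub>U\<^esub> leg12 R A w = leg12 R A w \<otimes>\<^bsub>U\<^esub> in3 a"
    by (rule T.tensor_ext[OF w, where P=U]; (intro linear_intros leg_linear)?) (simp_all add: a pure)
  show "leg23 R A w \<otimes>\<^bsub>U\<^esub> in1 a = in1 a \<otimes>\<^bsub>U\<^esub> leg23 R A w"
    by (rule T.tensor_ext[OF w, where P=U]; (intro linear_intros leg_linear)?) (simp_all add: a pure)
qed

text \<open>The formula rests on \<open>a \<otimes> b \<otimes> c = (a \<otimes> 1 \<otimes> 1)(1
  \<otimes> b \<otimes> c)\<close>. It holds for every \<open>w\<close> in \<open>T\<close>, and so
  applies to the non-pure element \<open>\<Delta> v\<close>.\<close>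

lemma tensor_assoc_linear: "tensor_assoc R A \<in> linear_hom R AT.TA U"
  and tensor_assoc_pure: "\<lbrakk>a \<in> carrier A; w \<in> carrier T\<rbrakk> \<Longrightarrow>
    tensor_assoc R A (pure_tensor R A T a w) = in1 a \<otimes>\<^bsub>U\<^esub> leg23 R A w"
proof -
  let ?\<beta> = "\<lambda>a. tensor_lift R U (\<lambda>b c. pure3 R A a b c)"
  have bil: "?\<beta> \<in> bilinear_maps R A T U"
  proof (rule bilinear_mapsI)
    show "?\<beta> a \<in> linear_hom R T U" if "a \<in> carrier A" for a
      by (intro T.lift_linear U_module pure3_bilinear that)
    show "(\<lambda>a. ?\<beta> a w) \<in> linear_hom R A U" if "w \<in> carrier T" for w
      by (intro T.lift_parameter[OF U_module module_axioms] pure3_bilinear linear_intros that)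
  qed
  show "tensor_assoc R A \<in> linear_hom R AT.TA U"
    unfolding tensor_assoc_def by (rule AT.lift_linear[OF U_module bil])
  assume a: "a \<in> carrier A" and w: "w \<in> carrier T"
  have "tensor_assoc R A (pure_tensor R A T a w) = ?\<beta> a w"
    unfolding tensor_assoc_def by (rule AT.lift_pure[OF U_module bil a w])
  also have "\<dots> = in1 a \<otimes>\<^bsub>U\<^esub> leg23 R A w"
    using w
  proof (rule T.tensor_ext)
    show "?\<beta> a \<in> linear_hom R T U"
      by (rule bilinear_mapsD(1)[OF bil a])
    show "(\<lambda>w. in1 a \<otimes>\<^bsub>U\<^esub> leg23 R A w) \<in> linear_hom R T U"
      using a by (intro linear_intros leg_linear) auto
    show "?\<beta> a (x \<bullet> y) = in1 a \<otimes>\<^bsub>U\<^esub> leg23 R A (x \<bullet> y)" if "x \<in> carrier A" "y \<in> carrier A" for x y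
      using a that by (simp add: T.lift_pure[OF U_module] pure3_bilinear leg_pure T.pure_mult U.pure_mult)
  qed
  finally show "tensor_assoc R A (pure_tensor R A T a w) = in1 a \<otimes>\<^bsub>U\<^esub> leg23 R A w" .
qed

section \<open>The coproduct, its legs and the two sides of coassociativity\<close>

context
  fixes lam r
  assumes lam: "lam \<in> carrier R" and r: "r \<in> carrier T"
begin

abbreviation "\<Delta> \<equiv> coproduct R A lam r"

lemma coproduct_eq:
  "a \<in> carrier A \<Longrightarrow>
    \<Delta> a = (a \<bullet> \<one>\<^bsub>A\<^esub>) \<otimes>\<^bsub>T\<^esub> r \<ominus>\<^bsub>T\<^esub> r \<otimes>\<^bsub>T\<^esub> (\<one>\<^bsub>A\<^esub> \<bullet> a) \<ominus>\<^bsub>T\<^esub> lam \<odot>\<^bsub>T\<^esub> (a \<bullet> \<one>\<^bsub>A\<^esub>)"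
  using r by (simp add: coproduct_def left_act2_eq right_act2_eq)

lemma coproduct_linear: "\<Delta> \<in> linear_hom R A T"
proof -
  have "(\<lambda>a. (a \<bullet> \<one>\<^bsub>A\<^esub>) \<otimes>\<^bsub>T\<^esub> r \<ominus>\<^bsub>T\<^esub> r \<otimes>\<^bsub>T\<^esub> (\<one>\<^bsub>A\<^esub> \<bullet> a) \<ominus>\<^bsub>T\<^esub> lam \<odot>\<^bsub>T\<^esub> (a \<bullet> \<one>\<^bsub>A\<^esub>)) \<in> linear_hom R A T"
    (is "?f \<in> _")
    using lam r by (intro linear_intros) auto
  note f = linear_homD[OF this]
  show ?thesis
    \<comment> \<open>\<open>coproduct_eq\<close> is available only on \<open>carrier A\<close>, so
      linearity is transferred pointwise rather than by rewriting the function.\<close>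
    by (rule linear_homI) (simp_all only: coproduct_eq f M.a_closed smult_closed)
qed

lemmas coproduct_closed [simp] = linear_homD(1)[OF coproduct_linear]

text \<open>These supply \<open>d12\<close>, \<open>d13\<close> and \<open>d23\<close> in
  \<open>coassoc_difference\<close>. The summand \<open>a \<otimes> 1\<close> lands in position 1
  for the 12- and 13-legs, but in position 2 for the 23-leg.\<close>

lemma coproduct_leg:
  assumes "a \<in> carrier A"
  shows "leg12 R A (\<Delta> a) = in1 a \<otimes>\<^bsub>U\<^esub> leg12 R A r \<ominus>\<^bsub>U\<^esub> leg12 R A r \<otimes>\<^bsub>U\<^esub> in2 a \<ominus>\<^bsub>U\<^esub> lam \<odot>\<^bsub>U\<^esub> in1 a"
    and "leg13 R A (\<Delta> a) = in1 a \<otimes>\<^bsub>U\<^esub> leg13 R A r \<ominus>\<^bsub>U\<^esub> leg13 R A r \<otimes>\<^bsub>U\<^esub> in3 a \<ominus>\<^bsub>U\<^esub> lam \<odot>\<^bsub>U\<^esub> in1 a"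
    and "leg23 R A (\<Delta> a) = in2 a \<otimes>\<^bsub>U\<^esub> leg23 R A r \<ominus>\<^bsub>U\<^esub> leg23 R A r \<otimes>\<^bsub>U\<^esub> in3 a \<ominus>\<^bsub>U\<^esub> lam \<odot>\<^bsub>U\<^esub> in2 a"
  using assms lam r
  by (simp_all add: coproduct_eq linear_hom_zero_minus(3)[OF T_module U_module leg_linear(1)]
      linear_hom_zero_minus(3)[OF T_module U_module leg_linear(2)]
      linear_hom_zero_minus(3)[OF T_module U_module leg_linear(3)]
      leg_linear[THEN linear_homD(3)] leg_mult leg_pure)

lemma coproduct_tensor_id:
  assumes w: "w \<in> carrier T"
  shows "tensor_map R T A \<Delta> (\<lambda>x. x) w = leg13 R A w \<otimes>\<^bsub>U\<^esub> leg12 R A r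
    \<ominus>\<^bsub>U\<^esub> leg12 R A r \<otimes>\<^bsub>U\<^esub> leg23 R A w \<ominus>\<^bsub>U\<^esub> lam \<odot>\<^bsub>U\<^esub> leg13 R A w"
proof (rule T.tensor_ext[OF w])
  show "tensor_map R T A \<Delta> (\<lambda>x. x) \<in> linear_hom R T U"
    by (intro U.tensor_map_linear coproduct_linear linear_hom_id T.unital_algebra_pair_axioms)
  show "(\<lambda>w. leg13 R A w \<otimes>\<^bsub>U\<^esub> leg12 R A r \<ominus>\<^bsub>U\<^esub> leg12 R A r \<otimes>\<^bsub>U\<^esub> leg23 R A w
      \<ominus>\<^bsub>U\<^esub> lam \<odot>\<^bsub>U\<^esub> leg13 R A w) \<in> linear_hom R T U"
    using r lam by (intro linear_intros leg_linear) auto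
  fix u v assume uv: "u \<in> carrier A" "v \<in> carrier A"
  have "tensor_map R T A \<Delta> (\<lambda>x. x) (u \<bullet> v) = \<Delta> u \<star> v"
    by (intro U.tensor_map_pure coproduct_linear linear_hom_id T.unital_algebra_pair_axioms uv)
  also have "\<dots> = ((u \<bullet> \<one>\<^bsub>A\<^esub>) \<otimes>\<^bsub>T\<^esub> r) \<star> v \<ominus>\<^bsub>U\<^esub> (r \<otimes>\<^bsub>T\<^esub> (\<one>\<^bsub>A\<^esub> \<bullet> u)) \<star> v \<ominus>\<^bsub>U\<^esub> lam \<odot>\<^bsub>U\<^esub> (u \<bullet> \<one>\<^bsub>A\<^esub> \<star> v)"
    using uv r lam linear_homD[OF U.pure_linear_left[OF uv(2) linear_hom_id]]
    by (simp add: coproduct_eq linear_hom_zero_minus(3)[OF T_module U_module U.pure_linear_left[OF uv(2) linear_hom_id]])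
  \<comment> \<open>Here \<open>(u \<otimes> 1) r \<otimes> v = (u \<otimes> 1 \<otimes> v)(r
    \<otimes> 1)\<close> and \<open>r (1 \<otimes> u) \<otimes> v = (r \<otimes> 1)(1 \<otimes> u
    \<otimes> v)\<close>, and the new factors are legs of \<open>u \<otimes> v\<close> and of
    \<open>r\<close>.\<close>
  also have "\<dots> = leg13 R A (u \<bullet> v) \<otimes>\<^bsub>U\<^esub> leg12 R A r \<ominus>\<^bsub>U\<^esub> leg12 R A r \<otimes>\<^bsub>U\<^esub> leg23 R A (u \<bullet> v)
      \<ominus>\<^bsub>U\<^esub> lam \<odot>\<^bsub>U\<^esub> leg13 R A (u \<bullet> v)"
    using uv r by (simp add: leg_pure leg12_eq U.pure_mult)
  finally show "tensor_map R T A \<Delta> (\<lambda>x. x) (u \<bullet> v) = \<dots>" .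
qed

lemma id_tensor_coproduct:
  assumes w: "w \<in> carrier T"
  shows "tensor_assoc R A (tensor_map R A T (\<lambda>x. x) \<Delta> w) = leg12 R A w \<otimes>\<^bsub>U\<^esub> leg23 R A r
    \<ominus>\<^bsub>U\<^esub> leg23 R A r \<otimes>\<^bsub>U\<^esub> leg13 R A w \<ominus>\<^bsub>U\<^esub> lam \<odot>\<^bsub>U\<^esub> leg12 R A w"
proof (rule T.tensor_ext[OF w])
  show "(\<lambda>w. tensor_assoc R A (tensor_map R A T (\<lambda>x. x) \<Delta> w)) \<in> linear_hom R T U"
    by (intro linear_hom_compose[OF tensor_assoc_linear] AT.tensor_map_linear coproduct_linear
        linear_hom_id T.unital_algebra_pair_axioms)
  show "(\<lambda>w. leg12 R A w \<otimes>\<^bsub>U\<^esub> leg23 R A r \<ominus>\<^bsub>U\<^esub> leg23 R A r \<otimes>\<^bsub>U\<^esub> leg13 R A w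
      \<ominus>\<^bsub>U\<^esub> lam \<odot>\<^bsub>U\<^esub> leg12 R A w) \<in> linear_hom R T U"
    using r lam by (intro linear_intros leg_linear) auto
  fix u v assume uv: "u \<in> carrier A" "v \<in> carrier A"
  have "tensor_map R A T (\<lambda>x. x) \<Delta> (u \<bullet> v) = pure_tensor R A T u (\<Delta> v)"
    by (intro AT.tensor_map_pure coproduct_linear linear_hom_id T.unital_algebra_pair_axioms uv)
  then have "tensor_assoc R A (tensor_map R A T (\<lambda>x. x) \<Delta> (u \<bullet> v)) = in1 u \<otimes>\<^bsub>U\<^esub> leg23 R A (\<Delta> v)"
    using uv by (simp add: tensor_assoc_pure)
  also have "\<dots> = in1 u \<otimes>\<^bsub>U\<^esub> in2 v \<otimes>\<^bsub>U\<^esub> leg23 R A r \<ominus>\<^bsub>U\<^esub> in1 u \<otimes>\<^bsub>U\<^esub> leg23 R A r \<otimes>\<^bsub>U\<^esub> in3 v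
      \<ominus>\<^bsub>U\<^esub> lam \<odot>\<^bsub>U\<^esub> (in1 u \<otimes>\<^bsub>U\<^esub> in2 v)"
    using uv r lam
    by (simp add: coproduct_leg U.TA.A.minus_distr U.TA.smult_mult_right U.TA.A.m_assoc)
  \<comment> \<open>In the middle term \<open>in1 u\<close> must pass the 23-leg of \<open>r\<close>
    to meet \<open>in3 v\<close>; together they form the 13-leg of \<open>u \<otimes> v\<close>,
    just as \<open>in1 u\<close> and \<open>in2 v\<close> form its 12-leg.\<close>
  also have "in1 u \<otimes>\<^bsub>U\<^esub> leg23 R A r = leg23 R A r \<otimes>\<^bsub>U\<^esub> in1 u"
    using uv r by (simp add: leg_commute)
  also have "leg23 R A r \<otimes>\<^bsub>U\<^esub> in1 u \<otimes>\<^bsub>U\<^esub> in3 v = leg23 R A r \<otimes>\<^bsub>U\<^esub> (in1 u \<otimes>\<^bsub>U\<^esub> in3 v)"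
    using uv r by (simp add: U.TA.A.m_assoc)
  also have "in1 u \<otimes>\<^bsub>U\<^esub> in2 v = leg12 R A (u \<bullet> v)"
    using uv by (simp add: leg_pure U.pure_mult T.pure_mult)
  also have "in1 u \<otimes>\<^bsub>U\<^esub> in3 v = leg13 R A (u \<bullet> v)"
    using uv by (simp add: leg_pure U.pure_mult T.pure_mult)
  finally show "tensor_assoc R A (tensor_map R A T (\<lambda>x. x) \<Delta> (u \<bullet> v)) =
      leg12 R A (u \<bullet> v) \<otimes>\<^bsub>U\<^esub> leg23 R A r \<ominus>\<^bsub>U\<^esub> leg23 R A r \<otimes>\<^bsub>U\<^esub> leg13 R A (u \<bullet> v)
      \<ominus>\<^bsub>U\<^esub> lam \<odot>\<^bsub>U\<^esub> leg12 R A (u \<bullet> v)" .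
qed

lemma coassociative_at_iff:
  assumes a: "a \<in> carrier A"
  shows "tensor_map R T A \<Delta> (\<lambda>x. x) (\<Delta> a) = tensor_assoc R A (tensor_map R A T (\<lambda>x. x) \<Delta> (\<Delta> a)) \<longleftrightarrow>
    left_act3 R A a (yang_baxter_element R A lam r) = right_act3 R A (yang_baxter_element R A lam r) a"
    (is "?L = ?R \<longleftrightarrow> _")
proof -
  define Y where "Y = yang_baxter_element R A lam r"
  have Y: "Y = leg13 R A r \<otimes>\<^bsub>U\<^esub> leg12 R A r \<ominus>\<^bsub>U\<^esub> leg12 R A r \<otimes>\<^bsub>U\<^esub> leg23 R A r
      \<oplus>\<^bsub>U\<^esub> leg23 R A r \<otimes>\<^bsub>U\<^esub> leg13 R A r \<ominus>\<^bsub>U\<^esub> lam \<odot>\<^bsub>U\<^esub> leg13 R A r"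
    by (simp add: Y_def yang_baxter_element_def Let_def)
  then have Y_closed: "Y \<in> carrier U" using r lam by simp
  have in_closed: "in1 a \<in> carrier U" "in2 a \<in> carrier U" "in3 a \<in> carrier U"
    using a by auto
  have L: "?L \<in> carrier U" and R: "?R \<in> carrier U"
    using a r lam by (simp_all add: coproduct_tensor_id id_tensor_coproduct)
  \<comment> \<open>This says that the defect of coassociativity at \<open>a\<close> is
    \<open>in1 a\<close> times \<open>Y\<close> minus \<open>Y\<close> times \<open>in3 a\<close>.
    Written with sums, it yields either direction below by one additive cancellation.\<close>
  have key: "?L \<oplus>\<^bsub>U\<^esub> Y \<otimes>\<^bsub>U\<^esub> in3 a = ?R \<oplus>\<^bsub>U\<^esub> in1 a \<otimes>\<^bsub>U\<^esub> Y"
    unfolding coproduct_tensor_id[OF coproduct_closed[OF a]] id_tensor_coproduct[OF coproduct_closed[OF a]]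
    by (rule U.TA.coassoc_difference[OF lam in_closed _ _ _ leg_commute[OF a r] coproduct_leg[OF a] Y])
      (use r in simp_all)
  have "?L = ?R \<longleftrightarrow> in1 a \<otimes>\<^bsub>U\<^esub> Y = Y \<otimes>\<^bsub>U\<^esub> in3 a"
  proof
    assume "?L = ?R"
    with key L R Y_closed in_closed show "in1 a \<otimes>\<^bsub>U\<^esub> Y = Y \<otimes>\<^bsub>U\<^esub> in3 a" by simp
  next
    assume "in1 a \<otimes>\<^bsub>U\<^esub> Y = Y \<otimes>\<^bsub>U\<^esub> in3 a"
    with key L R Y_closed in_closed show "?L = ?R" by simp
  qed
  with a Y_closed show ?thesis
    by (simp add: Y_def[symmetric] left_act3_eq right_act3_eq)
qed

end

end

theorem theorem1p1:
  fixes R :: "('k, 'r) ring_scheme" and A :: "('k, 'a, 'u) module_scheme"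
    and lam :: 'k and r :: "('a \<times> 'a \<Rightarrow> 'k) set"
  assumes "unital_algebra R A"
    and "lam \<in> carrier R"
    and "r \<in> carrier (tensor2 R A)"
  shows "coproduct R A lam r \<in> linear_hom R A (tensor2 R A) \<and>
    (coassociative R A (coproduct R A lam r) \<longleftrightarrow>
     bimodule_invariant A (left_act3 R A) (right_act3 R A) (yang_baxter_element R A lam r))"
proof -
  interpret tensor_cube R A
    by (rule tensor_cube.intro) fact
  \<comment> \<open>Coassociativity and invariance quantify over the same \<open>a\<close>, so the
    equivalence at each \<open>a\<close> suffices.\<close>
  show ?thesis
    unfolding coassociative_def bimodule_invariant_def
    using coproduct_linear[OF assms(2,3)] coassociative_at_iff[OF assms(2,3)] by blast
qed

end
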